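(* For all $j,k\in\mathbb N$, the $j$-finitary part of $\mathrm{TT}^1_k$ is Weihrauch equivalent to $\mathrm{RT}^1_{\min\{j,k\}}$, i.e. $\operatorname{Fin}_j(\mathrm{TT}^1_k)\equiv_W \mathrm{RT}^1_{\min\{j,k\}}$.
   Context: Problems are partial multivalued functions $f:\subseteq\mathbf X\rightrightarrows\mathbf Y$ between represented spaces. A realizer of $f$ is a partial function $F:\subseteq\mathbb N^{\mathbb N}\to\mathbb N^{\mathbb N}$ mapping every name of every $x\in\operatorname{dom}(f)$ to a name of some element of $f(x)$. Weihrauch reducibility: $f\le_W g$ iff there are computable $H,K:\subseteq\mathbb N^{\mathbb N}\to\mathbb N^{\mathbb N}$ such that for every realizer $G$ of $g$, the map $p\mapsto H(p,G(K(p)))$ is a realizer of $f$; $\equiv_W$ is the induced equivalence. Write $\mathbf k=\{0,\dots,k-1\}$. $\mathrm{RT}^1_k$ is the problem: given $c:\mathbb N\to\mathbf k$, return some $i\in\mathbf k$ with $c^{-1}(i)$ infinite. $2^{<\omega}$ is the set of finite binary strings ordered by the prefix relation $\preceq$. $\mathrm{TT}^1_k$ is the problem: given $c:2^{<\omega}\to\mathbf k$, return a set $S\subseteq 2^{<\omega}$ with $(S,\preceq)\cong(2^{<\omega},\preceq)$ on which $c$ is constant. The $j$-finitary part $\operatorname{Fin}_j(f)$ of a problem $f$ is the $\le_W$-greatest Weihrauch degree of a problem with codomain $\mathbf j$ which is Weihrauch reducible to $f$. *)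

theory Defs
  imports Main "HOL-Library.Nat_Bijection" "HOL-Library.Sublist"
begin

type_synonym baire = "nat \<Rightarrow> nat"

section \<open>Computable partial functions on Baire space\<close>

text \<open>
  Kleene's partial recursive functions relative to an oracle \<open>p\<close>, presented with unary
  functions on the natural numbers; several arguments are passed via \<open>prod_encode\<close>.
\<close>

datatype prog =
    Zero | Succ | Left | Right | Query
  | Join prog prog | Comp prog prog | Prec prog prog | Mu prog

inductive eval :: "baire \<Rightarrow> prog \<Rightarrow> nat \<Rightarrow> nat \<Rightarrow> bool" for p :: baire where
  eval_zero: "eval p Zero n 0"
| eval_succ: "eval p Succ n (Suc n)"
| eval_left: "eval p Left (prod_encode (a, b)) a"
| eval_right: "eval p Right (prod_encode (a, b)) b"
| eval_query: "eval p Query n (p n)"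
| eval_join: "eval p f n a \<Longrightarrow> eval p g n b \<Longrightarrow> eval p (Join f g) n (prod_encode (a, b))"
| eval_comp: "eval p g n a \<Longrightarrow> eval p f a b \<Longrightarrow> eval p (Comp f g) n b"
| eval_prec_0: "eval p f a r \<Longrightarrow> eval p (Prec f g) (prod_encode (a, 0)) r"
| eval_prec_Suc: "eval p (Prec f g) (prod_encode (a, m)) r \<Longrightarrow>
    eval p g (prod_encode (a, prod_encode (m, r))) s \<Longrightarrow>
    eval p (Prec f g) (prod_encode (a, Suc m)) s"
| eval_mu: "eval p f (prod_encode (a, m)) 0 \<Longrightarrow>
    (\<And>i. i < m \<Longrightarrow> \<exists>v. eval p f (prod_encode (a, i)) (Suc v)) \<Longrightarrow>
    eval p (Mu f) a m"

text \<open>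
  As usual in computable analysis, the domain of a computable function is not required to be
  the natural domain of an algorithm: restrictions of computable functions are computable.
\<close>

definition computable :: "(baire \<rightharpoonup> baire) \<Rightarrow> bool" where
  "computable F \<longleftrightarrow> (\<exists>e. \<forall>p q. F p = Some q \<longrightarrow> (\<forall>n. eval p e n (q n)))"

definition bpair :: "baire \<Rightarrow> baire \<Rightarrow> baire" where
  "bpair p q n = (if even n then p (n div 2) else q (n div 2))"

section \<open>Problems between represented spaces\<close>

text \<open>
  A represented space is given by its representation, a partial surjection from Baire space
  onto the underlying set; hence the underlying set is \<open>ran \<delta>\<close>.
\<close>

type_synonym 'a rep_space = "baire \<rightharpoonup> 'a"

text \<open>The domain of a problem consists of the instances with a nonempty set of solutions.\<close>

record ('x, 'y) problem =
  src :: "'x rep_space"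
  tgt :: "'y rep_space"
  sol :: "'x \<Rightarrow> 'y set"

definition is_problem :: "('x, 'y) problem \<Rightarrow> bool" where
  "is_problem f \<longleftrightarrow> {x. sol f x \<noteq> {}} \<subseteq> ran (src f) \<and> (\<forall>x. sol f x \<subseteq> ran (tgt f))"

definition realizes :: "(baire \<rightharpoonup> baire) \<Rightarrow> ('x, 'y) problem \<Rightarrow> bool" where
  "realizes F f \<longleftrightarrow>
    (\<forall>p x. src f p = Some x \<and> sol f x \<noteq> {} \<longrightarrow>
       (\<exists>q y. F p = Some q \<and> tgt f q = Some y \<and> y \<in> sol f x))"

definition weihrauch_le :: "('a, 'b) problem \<Rightarrow> ('c, 'd) problem \<Rightarrow> bool"
    (infix "\<le>\<^sub>W" 50) where
  "f \<le>\<^sub>W g \<longleftrightarrow>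
    (\<exists>H K. computable H \<and> computable K \<and>
       (\<forall>G. realizes G g \<longrightarrow>
          realizes (\<lambda>p. Option.bind (K p) (\<lambda>r. Option.bind (G r) (\<lambda>q. H (bpair p q)))) f))"

definition weihrauch_equiv :: "('a, 'b) problem \<Rightarrow> ('c, 'd) problem \<Rightarrow> bool"
    (infix "\<equiv>\<^sub>W" 50) where
  "f \<equiv>\<^sub>W g \<longleftrightarrow> f \<le>\<^sub>W g \<and> g \<le>\<^sub>W f"

section \<open>The finitary part of a problem\<close>

definition fin_space :: "nat \<Rightarrow> nat rep_space" where
  "fin_space j p = (if p 0 < j then Some (p 0) else None)"

text \<open>
  \<open>F\<close> represents the greatest degree of a problem with codomain \<open>{..<j}\<close> that is reducible
  to \<open>f\<close>. The competing problems \<open>h\<close> have arbitrary represented input spaces with points in the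
  type \<open>'x\<close>; since HOL cannot quantify over types inside a formula, \<open>'x\<close> is a parameter, to
  be left as a free type variable in theorems that use this notion.
\<close>

definition is_finitary_part ::
    "'x itself \<Rightarrow> nat \<Rightarrow> ('a, 'b) problem \<Rightarrow> ('w, nat) problem \<Rightarrow> bool" where
  "is_finitary_part _ j f F \<longleftrightarrow>
     is_problem F \<and> tgt F = fin_space j \<and> F \<le>\<^sub>W f \<and>
     (\<forall>h :: ('x, nat) problem.
        is_problem h \<and> tgt h = fin_space j \<and> h \<le>\<^sub>W f \<longrightarrow> h \<le>\<^sub>W F)"

section \<open>The infinite pigeonhole principle\<close>

definition seq_colouring_space :: "nat \<Rightarrow> (nat \<Rightarrow> nat) rep_space" where
  "seq_colouring_space k p = (if \<forall>n. p n < k then Some p else None)"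

definition RT1 :: "nat \<Rightarrow> (nat \<Rightarrow> nat, nat) problem" where
  "RT1 k = \<lparr>src = seq_colouring_space k, tgt = fin_space k,
     sol = (\<lambda>c. {i. (\<forall>n. c n < k) \<and> i < k \<and> infinite (c -` {i})})\<rparr>"

section \<open>The tree theorem for singletons\<close>

text \<open>
  Strings are numbered in heap order: the root gets 0, the children of node \<open>n\<close> get
  \<open>2 * n + 1\<close> and \<open>2 * n + 2\<close>.
\<close>

definition node_code :: "bool list \<Rightarrow> nat" where
  "node_code \<sigma> = foldl (\<lambda>n b. 2 * n + (if b then 2 else 1)) 0 \<sigma>"

definition tree_colouring_space :: "nat \<Rightarrow> (bool list \<Rightarrow> nat) rep_space" where
  "tree_colouring_space k p =
     (if \<forall>n. p n < k then Some (\<lambda>\<sigma>. p (node_code \<sigma>)) else None)"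

text \<open>Sets of strings are named by their characteristic functions.\<close>

definition string_set_space :: "bool list set rep_space" where
  "string_set_space p =
     (if \<forall>n. p n \<in> {0, 1} then Some {\<sigma>. p (node_code \<sigma>) = 1} else None)"

definition iso_full_tree :: "bool list set \<Rightarrow> bool" where
  "iso_full_tree S \<longleftrightarrow>
     (\<exists>\<phi>. bij_betw \<phi> UNIV S \<and> (\<forall>\<sigma> \<tau> :: bool list. prefix \<sigma> \<tau> \<longleftrightarrow> prefix (\<phi> \<sigma>) (\<phi> \<tau>)))"

definition TT1 :: "nat \<Rightarrow> (bool list \<Rightarrow> nat, bool list set) problem" where
  "TT1 k = \<lparr>src = tree_colouring_space k, tgt = string_set_space,
     sol = (\<lambda>c. {S. (\<forall>\<sigma>. c \<sigma> < k) \<and> iso_full_tree S \<and> (\<exists>i. \<forall>\<sigma>\<in>S. c \<sigma> = i)})\<rparr>"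

section \<open>Well-definedness\<close>

lemma node_code_snoc: "node_code (\<sigma> @ [b]) = 2 * node_code \<sigma> + (if b then 2 else 1)"
  by (simp add: node_code_def)

lemma bij_node_code: "bij node_code"
proof (rule bijI)
  show "inj node_code"
  proof (rule injI)
    fix \<sigma> \<tau> show "node_code \<sigma> = node_code \<tau> \<Longrightarrow> \<sigma> = \<tau>"
    proof (induction \<sigma> arbitrary: \<tau> rule: rev_induct)
      case Nil
      then show ?case
        by (cases \<tau> rule: rev_cases) (auto simp: node_code_snoc, simp_all add: node_code_def split: if_splits)
    next
      case (snoc b \<sigma>)
      obtain \<tau>' b' where \<tau>: "\<tau> = \<tau>' @ [b']"
        using snoc.prems
        by (cases \<tau> rule: rev_cases) (simp_all add: node_code_snoc, simp add: node_code_def split: if_splits)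
      have "b = b' \<and> node_code \<sigma> = node_code \<tau>'"
        using snoc.prems unfolding \<tau> node_code_snoc by (auto split: if_splits; presburger)
      then show ?case using snoc.IH \<tau> by auto
    qed
  qed
  have "\<exists>\<sigma>. node_code \<sigma> = n" for n
  proof (induction n rule: less_induct)
    case (less n)
    show ?case
    proof (cases "n = 0")
      case True
      then show ?thesis by (intro exI[of _ "[]"]) (simp add: node_code_def)
    next
      case False
      then have "(n - 1) div 2 < n" by linarith
      then obtain \<sigma> where "node_code \<sigma> = (n - 1) div 2"
        using less.IH by blast
      then have "node_code (\<sigma> @ [even n]) = n"
        using False by (auto simp: node_code_snoc elim!: evenE oddE)
      then show ?thesis by blast
    qed
  qed
  then show "surj node_code" by (metis surjI)
qed

lemma ran_seq_colouring_space: "ran (seq_colouring_space k) = {c. \<forall>n. c n < k}"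
  by (auto simp: ran_def seq_colouring_space_def split: if_splits)

lemma ran_fin_space: "ran (fin_space j) = {..<j}"
proof -
  have "i \<in> ran (fin_space j)" if "i < j" for i
    using that by (intro ranI[of _ "\<lambda>_. i"]) (simp add: fin_space_def)
  then show ?thesis by (auto simp: ran_def fin_space_def split: if_splits)
qed

lemma ran_tree_colouring_space: "ran (tree_colouring_space k) = {c. \<forall>\<sigma>. c \<sigma> < k}"
proof -
  have "c \<in> ran (tree_colouring_space k)" if "\<forall>\<sigma>. c \<sigma> < k" for c
    using that bij_node_code
    by (intro ranI[of _ "c \<circ> inv node_code"])
       (simp add: tree_colouring_space_def bij_is_inj)
  moreover have "\<forall>\<sigma>. c \<sigma> < k" if "c \<in> ran (tree_colouring_space k)" for c
    using that by (auto simp: ran_def tree_colouring_space_def split: if_splits)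
  ultimately show ?thesis by blast
qed

lemma ran_string_set_space: "ran string_set_space = UNIV"
proof -
  have "S \<in> ran string_set_space" for S
    using bij_node_code
    by (intro ranI[of _ "\<lambda>n. of_bool (inv node_code n \<in> S)"])
       (simp add: string_set_space_def bij_is_inj)
  then show ?thesis by blast
qed

lemma is_problem_RT1: "is_problem (RT1 k)"
  by (auto simp: is_problem_def RT1_def ran_seq_colouring_space ran_fin_space)

lemma is_problem_TT1: "is_problem (TT1 k)"
  by (auto simp: is_problem_def TT1_def ran_tree_colouring_space ran_string_set_space)

end

theory Submission
  imports Defs
begin

text \<open>
  A monochromatic copy of the tree is an infinite set of nodes, so colouring the node with number
  \<open>n\<close> by \<open>c n\<close> reduces the pigeonhole principle for \<open>min j k\<close> colours to the tree theorem.

  Conversely let a problem with answers below \<open>j\<close> be reduced to the tree theorem. A finite monochromatic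
  tree from which an answer is computed guarantees that this answer is correct as soon as its colour is
  dense above some node above each of its nodes. From a node \<open>x\<close> one can compute a sequence of colours
  almost all of which are somewhere dense above \<open>x\<close>. It remains to choose, for every colour that is
  needed, a single answer (this matters if \<open>k < j\<close>) in such a way that whenever every node selects one of
  its somewhere dense colours, some finite tree with the chosen answer has its colour selected above all
  of its nodes. Answers are fixed one colour at a time, as soon as a finite part of the tree is found that
  has this property robustly, for all selections and under partitions. When no further answer can be
  fixed, partitioning the nodes by the answers available above them yields a part in which only colours
  with a fixed answer are somewhere dense.
\<close>

section \<open>Relative computability\<close>

text \<open>Two obstacles shape the argument. Which colours are somewhere dense above a node cannot
  be decided: \<open>pick\<close> lies among them from some stage on, but need not converge. This is
  why trees are demanded for all selections at once. Moreover, if \<open>k < j\<close>, a realizer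
  of \<open>RT1\<close> returns a colour without the stage at which it was proposed, so the answer
  must be recoverable from the instance and the colour alone; a commitment can never be revised. It
  can be made safely because it claims nothing about correctness: it says only that every selection
  of assigned colours admits a tree with a promised answer. Correctness comes later, from the
  density of the selected colours, since the tree can then be completed by nodes beyond its fuel,
  which the computation has not queried. Existence rests on minimality and compactness: a cone with
  fewest colours gives a dense colour, a subtree with fewest possible answers gives an answer worth
  committing to, and compactness of the space of labellings gives a finite part of the tree that
  witnesses it.\<close>

definition total_rec :: "(baire \<Rightarrow> nat \<Rightarrow> nat) \<Rightarrow> bool" where
  "total_rec F \<longleftrightarrow> (\<exists>e. \<forall>q n. eval q e n (F q n))"

abbreviation dec :: "(baire \<Rightarrow> nat \<Rightarrow> bool) \<Rightarrow> bool" where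
  "dec P \<equiv> total_rec (\<lambda>q n. of_bool (P q n))"

definition code_fst :: "nat \<Rightarrow> nat" where "code_fst n = fst (prod_decode n)"
definition code_snd :: "nat \<Rightarrow> nat" where "code_snd n = snd (prod_decode n)"

lemma code_fst_prod_encode [simp]: "code_fst (prod_encode (a, b)) = a"
  and code_snd_prod_encode [simp]: "code_snd (prod_encode (a, b)) = b"
  and prod_encode_code_fst_code_snd [simp]: "prod_encode (code_fst n, code_snd n) = n"
  by (simp_all add: code_fst_def code_snd_def)

text \<open>The least witness below \<open>t\<close>, with \<open>t\<close> itself for failure. The
  accumulator stops at the first witness and otherwise grows with the counter, so primitive
  recursion suffices.\<close>

definition first :: "(nat \<Rightarrow> bool) \<Rightarrow> nat \<Rightarrow> nat" where
  "first P t = rec_nat 0 (\<lambda>_ r. if P r then r else Suc r) t"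

lemma first_le: "first P t \<le> t"
  by (induction t) (auto simp: first_def)

lemma not_less_first: "i < first P t \<Longrightarrow> \<not> P i"
  by (induction t) (auto simp: first_def less_Suc_eq split: if_splits)

lemma first_le_if: "P i \<Longrightarrow> first P t \<le> i"
  using not_less_first[of i P t] by (cases "first P t \<le> i") auto

lemma first_less: "first P t < t \<Longrightarrow> P (first P t)"
proof (induction t)
  case (Suc t)
  then show ?case using first_le[of P t]
    by (cases "first P t < t") (auto simp: first_def split: if_splits)
qed (simp add: first_def)

lemma first_eq: "P i \<Longrightarrow> (\<And>i'. i' < i \<Longrightarrow> \<not> P i') \<Longrightarrow> i \<le> t \<Longrightarrow> first P t = i"
  by (metis first_le first_less not_less_first le_neq_implies_less linorder_less_linear order_le_less_trans)

named_theorems rec_intros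

section \<open>Closure properties of total recursive functionals\<close>

lemma total_rec_comp:
  assumes "total_rec F" "total_rec G"
  shows "total_rec (\<lambda>q n. F q (G q n))"
proof -
  obtain e e' where "\<forall>q n. eval q e n (F q n)" "\<forall>q n. eval q e' n (G q n)"
    using assms unfolding total_rec_def by blast
  then show ?thesis
    unfolding total_rec_def by (intro exI[of _ "Comp e e'"]) (blast intro: eval_comp)
qed

lemma total_rec_const [rec_intros]: "total_rec (\<lambda>q n. c)"
proof (induction c)
  case 0
  then show ?case unfolding total_rec_def by (blast intro: eval_zero)
next
  case (Suc c)
  then obtain e where "\<forall>q n. eval q e n c" unfolding total_rec_def by blast
  then show ?case
    unfolding total_rec_def by (intro exI[of _ "Comp Succ e"]) (blast intro: eval_comp eval_succ)
qed

lemma eval_code_fst: "eval q Left n (code_fst n)" and eval_code_snd: "eval q Right n (code_snd n)"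
  using eval_left[of q "code_fst n" "code_snd n"] eval_right[of q "code_fst n" "code_snd n"] by simp_all

lemma total_rec_id [rec_intros]: "total_rec (\<lambda>q n. n)"
  unfolding total_rec_def
  by (rule exI[of _ "Join Left Right"]) (metis eval_join eval_code_fst eval_code_snd prod_encode_code_fst_code_snd)

lemma total_rec_code_fst [rec_intros]:
  assumes "total_rec F" shows "total_rec (\<lambda>q n. code_fst (F q n))"
proof -
  have "total_rec (\<lambda>q n. code_fst n)" unfolding total_rec_def by (blast intro: eval_code_fst)
  from total_rec_comp[OF this assms] show ?thesis .
qed

lemma total_rec_code_snd [rec_intros]:
  assumes "total_rec F" shows "total_rec (\<lambda>q n. code_snd (F q n))"
proof -
  have "total_rec (\<lambda>q n. code_snd n)" unfolding total_rec_def by (blast intro: eval_code_snd)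
  from total_rec_comp[OF this assms] show ?thesis .
qed

lemma total_rec_Suc [rec_intros]:
  assumes "total_rec F" shows "total_rec (\<lambda>q n. Suc (F q n))"
proof -
  have "total_rec (\<lambda>q n. Suc n)" unfolding total_rec_def by (blast intro: eval_succ)
  from total_rec_comp[OF this assms] show ?thesis .
qed

lemma total_rec_query:
  assumes "total_rec F" shows "total_rec (\<lambda>q n. q (F q n))"
proof -
  have "total_rec (\<lambda>q n. q n)" unfolding total_rec_def by (blast intro: eval_query)
  from total_rec_comp[OF this assms] show ?thesis .
qed

lemma total_rec_pair [rec_intros]:
  assumes "total_rec F" "total_rec G" shows "total_rec (\<lambda>q n. prod_encode (F q n, G q n))"
proof -
  obtain e e' where "\<forall>q n. eval q e n (F q n)" "\<forall>q n. eval q e' n (G q n)"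
    using assms unfolding total_rec_def by blast
  then show ?thesis
    unfolding total_rec_def by (intro exI[of _ "Join e e'"]) (blast intro: eval_join)
qed

text \<open>An operation of two arguments is shown computable on codes of pairs, where its arguments
  are projections, and reinstated here for arbitrary computable arguments.\<close>

lemma total_rec_comp2:
  assumes "total_rec (\<lambda>q z. F q (code_fst z) (code_snd z))" "total_rec A" "total_rec B"
  shows "total_rec (\<lambda>q n. F q (A q n) (B q n))"
  using total_rec_comp[OF assms(1) total_rec_pair[OF assms(2,3)]] by simp

lemma total_rec_comp3:
  assumes "total_rec (\<lambda>q z. F q (code_fst z) (code_fst (code_snd z)) (code_snd (code_snd z)))"
    "total_rec A" "total_rec B" "total_rec C"
  shows "total_rec (\<lambda>q n. F q (A q n) (B q n) (C q n))"
  using total_rec_comp[OF assms(1) total_rec_pair[OF assms(2) total_rec_pair[OF assms(3,4)]]] by simp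

lemma total_rec_rec [rec_intros]:
  assumes "total_rec F" "total_rec (\<lambda>q z. G q (code_fst z) (code_fst (code_snd z)) (code_snd (code_snd z)))" "total_rec T"
  shows "total_rec (\<lambda>q n. rec_nat (F q n) (G q n) (T q n))"
proof -
  obtain e e' where e: "\<forall>q n. eval q e n (F q n)"
    and e': "\<forall>q z. eval q e' z (G q (code_fst z) (code_fst (code_snd z)) (code_snd (code_snd z)))"
    using assms(1,2) unfolding total_rec_def by blast
  have "eval q (Prec e e') (prod_encode (n, m)) (rec_nat (F q n) (G q n) m)" for q n m
  proof (induction m)
    case 0
    then show ?case using e by (simp add: eval_prec_0)
  next
    case (Suc m)
    show ?case
      using eval_prec_Suc[OF Suc e'[rule_format, of q "prod_encode (n, prod_encode (m, rec_nat (F q n) (G q n) m))"]]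
      by simp
  qed
  then have "eval q (Prec e e') z (rec_nat (F q (code_fst z)) (G q (code_fst z)) (code_snd z))" for q z
    by (metis prod_encode_code_fst_code_snd)
  then have "total_rec (\<lambda>q z. rec_nat (F q (code_fst z)) (G q (code_fst z)) (code_snd z))"
    unfolding total_rec_def by blast
  from total_rec_comp[OF this total_rec_pair[OF total_rec_id assms(3)]] show ?thesis by simp
qed

lemma total_rec_add [rec_intros]:
  assumes "total_rec F" "total_rec G" shows "total_rec (\<lambda>q n. F q n + G q n)"
proof -
  have *: "a + b = rec_nat a (\<lambda>_ r. Suc r) b" for a b :: nat by (induction b) auto
  show ?thesis unfolding * by (intro rec_intros assms)
qed

lemma total_rec_mult [rec_intros]:
  assumes "total_rec F" "total_rec G" shows "total_rec (\<lambda>q n. F q n * G q n)"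
proof -
  have *: "a * b = rec_nat 0 (\<lambda>_ r. r + a) b" for a b :: nat by (induction b) auto
  show ?thesis unfolding * by (intro rec_intros assms total_rec_comp[OF assms(1)])
qed

lemma total_rec_power [rec_intros]:
  assumes "total_rec F" "total_rec G" shows "total_rec (\<lambda>q n. F q n ^ G q n)"
proof -
  have *: "a ^ b = rec_nat 1 (\<lambda>_ r. r * a) b" for a b :: nat by (induction b) auto
  show ?thesis unfolding * by (intro rec_intros assms total_rec_comp[OF assms(1)])
qed

lemma total_rec_diff [rec_intros]:
  assumes "total_rec F" "total_rec G" shows "total_rec (\<lambda>q n. F q n - G q n)"
proof -
  have p: "a - 1 = rec_nat 0 (\<lambda>m _. m) a" for a :: nat by (cases a) auto
  have *: "a - b = rec_nat a (\<lambda>_ r. rec_nat 0 (\<lambda>m _. m) r) b" for a b :: nat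
    by (induction b) (auto simp flip: p)
  show ?thesis unfolding * by (intro rec_intros assms)
qed

lemma total_rec_if [rec_intros]:
  assumes "dec P" "total_rec F" "total_rec G"
  shows "total_rec (\<lambda>q n. if P q n then F q n else G q n)"
proof -
  have *: "(if P q n then F q n else G q n) = of_bool (P q n) * F q n + (1 - of_bool (P q n)) * G q n"
    for q n by simp
  show ?thesis unfolding * by (intro rec_intros assms)
qed

lemma dec_le [rec_intros]:
  assumes "total_rec F" "total_rec G" shows "dec (\<lambda>q n. F q n \<le> G q n)"
proof -
  have *: "of_bool (a \<le> b) = 1 - (a - b)" for a b :: nat by auto
  show ?thesis unfolding * by (intro rec_intros assms)
qed

lemma dec_less [rec_intros]:
  assumes "total_rec F" "total_rec G" shows "dec (\<lambda>q n. F q n < G q n)"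
  unfolding less_eq_Suc_le by (intro rec_intros assms)

lemma dec_not [rec_intros]:
  assumes "dec P" shows "dec (\<lambda>q n. \<not> P q n)"
proof -
  have *: "of_bool (\<not> b) = (1::nat) - of_bool b" for b by simp
  show ?thesis unfolding * by (intro rec_intros assms)
qed

lemma dec_conj [rec_intros]:
  assumes "dec P" "dec P'" shows "dec (\<lambda>q n. P q n \<and> P' q n)"
  unfolding of_bool_conj by (intro rec_intros assms)

lemma dec_disj [rec_intros]:
  assumes "dec P" "dec P'" shows "dec (\<lambda>q n. P q n \<or> P' q n)"
proof -
  have *: "a \<or> b \<longleftrightarrow> \<not> (\<not> a \<and> \<not> b)" for a b by simp
  show ?thesis unfolding * by (intro rec_intros assms)
qed

lemma dec_imp [rec_intros]:
  assumes "dec P" "dec P'" shows "dec (\<lambda>q n. P q n \<longrightarrow> P' q n)"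
  unfolding imp_conv_disj by (intro rec_intros assms)

lemma dec_eq [rec_intros]:
  assumes "total_rec F" "total_rec G" shows "dec (\<lambda>q n. F q n = G q n)"
  unfolding order_eq_iff by (intro rec_intros assms)

lemma dec_ex [rec_intros]:
  assumes "total_rec T" "dec (\<lambda>q z. P q (code_fst z) (code_snd z))"
  shows "dec (\<lambda>q n. \<exists>m<T q n. P q n m)"
proof -
  have *: "of_bool (\<exists>m<t. R m) = rec_nat 0 (\<lambda>m r. if of_bool (R m) = (1::nat) then 1 else r) t"
    for R :: "nat \<Rightarrow> bool" and t
  proof (induction t)
    case (Suc t)
    have "(\<exists>m<Suc t. R m) \<longleftrightarrow> R t \<or> (\<exists>m<t. R m)" using less_Suc_eq by auto
    then show ?case using Suc.IH[symmetric] by simp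
  qed simp
  have "total_rec (\<lambda>q z. of_bool (P q (code_fst z) (code_fst (code_snd z))))"
    by (rule total_rec_comp2[of "\<lambda>q a b. of_bool (P q a b)"]) (intro assms rec_intros)+
  then show ?thesis unfolding * by (intro rec_intros assms(1))
qed

lemma dec_all [rec_intros]:
  assumes "total_rec T" "dec (\<lambda>q z. P q (code_fst z) (code_snd z))"
  shows "dec (\<lambda>q n. \<forall>m<T q n. P q n m)"
proof -
  have *: "(\<forall>m<t. R m) \<longleftrightarrow> \<not> (\<exists>m<t. \<not> R m)" for R :: "nat \<Rightarrow> bool" and t by simp
  show ?thesis unfolding * by (intro rec_intros assms)
qed

lemma total_rec_first [rec_intros]:
  assumes "dec (\<lambda>q z. P q (code_fst z) (code_snd z))" "total_rec T"
  shows "total_rec (\<lambda>q n. first (P q n) (T q n))"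
proof -
  have "dec (\<lambda>q z. P q (code_fst z) (code_snd (code_snd z)))"
    by (rule total_rec_comp2[of "\<lambda>q a b. of_bool (P q a b)"]) (intro assms rec_intros)+
  then show ?thesis unfolding first_def by (intro rec_intros assms(2))
qed

lemma total_rec_div [rec_intros]:
  assumes "total_rec F" "total_rec G" shows "total_rec (\<lambda>q n. F q n div G q n)"
proof -
  have *: "a div b = (if b = 0 then 0 else first (\<lambda>c. a < Suc c * b) a)" for a b :: nat
  proof (cases "b = 0")
    case False
    have "first (\<lambda>c. a < Suc c * b) a = a div b"
    proof (rule first_eq)
      show "a < Suc (a div b) * b" using False by (metis dividend_less_div_times mult_Suc neq0_conv)
      show "\<not> a < Suc i * b" if "i < a div b" for i
        using that False by (metis Suc_leI div_nat_eqI leD less_eq_div_iff_mult_less_eq neq0_conv)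
      show "a div b \<le> a" by simp
    qed
    then show ?thesis using False by simp
  qed simp
  show ?thesis unfolding *
    by (intro rec_intros assms total_rec_comp[OF assms(1)] total_rec_comp[OF assms(2)])
qed

lemma total_rec_mod [rec_intros]:
  assumes "total_rec F" "total_rec G" shows "total_rec (\<lambda>q n. F q n mod G q n)"
  unfolding minus_mult_div_eq_mod[symmetric] by (intro rec_intros assms)

lemma dec_even [rec_intros]:
  assumes "total_rec F" shows "dec (\<lambda>q n. even (F q n))"
  unfolding even_iff_mod_2_eq_zero by (intro rec_intros assms)

text \<open>
  The value \<open>0\<close> means that no result was found with fuel \<open>f\<close>, and \<open>Suc v\<close> means result \<open>v\<close>. The fuel
  also bounds the oracle queries, so that a result depends only on the oracle below \<open>f\<close>.
\<close>

primrec stage :: "prog \<Rightarrow> baire \<Rightarrow> nat \<Rightarrow> nat \<Rightarrow> nat" where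
  "stage Zero q f n = 1"
| "stage Succ q f n = Suc (Suc n)"
| "stage Left q f n = Suc (code_fst n)"
| "stage Right q f n = Suc (code_snd n)"
| "stage Query q f n = (if n < f then Suc (q n) else 0)"
| "stage (Join a b) q f n = (if stage a q f n = 0 \<or> stage b q f n = 0 then 0
     else Suc (prod_encode (stage a q f n - 1, stage b q f n - 1)))"
| "stage (Comp a b) q f n = (if stage b q f n = 0 then 0 else stage a q f (stage b q f n - 1))"
| "stage (Prec a b) q f n = rec_nat (stage a q f (code_fst n))
     (\<lambda>m r. if r = 0 then 0 else stage b q f (prod_encode (code_fst n, prod_encode (m, r - 1)))) (code_snd n)"
| "stage (Mu a) q f n =
     (if first (\<lambda>m. stage a q f (prod_encode (n, m)) \<le> 1) f < f \<and>
         stage a q f (prod_encode (n, first (\<lambda>m. stage a q f (prod_encode (n, m)) \<le> 1) f)) = 1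
      then Suc (first (\<lambda>m. stage a q f (prod_encode (n, m)) \<le> 1) f) else 0)"

lemma stage_local: "(\<And>m. m < f \<Longrightarrow> q m = q' m) \<Longrightarrow> stage e q f n = stage e q' f n"
  by (induction e arbitrary: n) (simp_all cong: if_cong)

text \<open>The value \<open>0\<close> (no result) also passes the test in \<open>Mu\<close>, so the
  search stalls at an undetermined argument instead of skipping it. Otherwise more fuel could change
  a result.\<close>

lemma stage_Mu_eqI:
  assumes "m < f" "stage a q f (prod_encode (n, m)) = 1"
    "\<And>i. i < m \<Longrightarrow> stage a q f (prod_encode (n, i)) > 1"
  shows "stage (Mu a) q f n = Suc m"
proof -
  have "first (\<lambda>m. stage a q f (prod_encode (n, m)) \<le> 1) f = m"
    using assms by (intro first_eq) (auto simp flip: not_less)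
  then show ?thesis using assms by simp
qed

lemma stage_MuD:
  assumes "stage (Mu a) q f n = Suc m"
  shows "m < f \<and> stage a q f (prod_encode (n, m)) = 1 \<and> (\<forall>i<m. stage a q f (prod_encode (n, i)) > 1)"
  using assms not_less_first[of _ "\<lambda>m. stage a q f (prod_encode (n, m)) \<le> 1" f]
  by (auto split: if_splits simp: not_le)

lemma stage_mono:
  assumes "f \<le> f'" shows "stage e q f n = Suc v \<Longrightarrow> stage e q f' n = Suc v"
proof (induction e arbitrary: n v)
  case (Join a b)
  then show ?case by (cases "stage a q f n"; cases "stage b q f n") auto
next
  case (Comp a b)
  then show ?case by (cases "stage b q f n") auto
next
  case (Prec a b)
  have "rec_nat (stage a q f x) (\<lambda>m r. if r = 0 then 0 else stage b q f (prod_encode (x, prod_encode (m, r - 1)))) y = Suc v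
    \<Longrightarrow> rec_nat (stage a q f' x) (\<lambda>m r. if r = 0 then 0 else stage b q f' (prod_encode (x, prod_encode (m, r - 1)))) y = Suc v"
    for x y v
  proof (induction y arbitrary: v)
    case 0
    then show ?case using Prec.IH(1) by simp
  next
    case (Suc y)
    let ?r = "rec_nat (stage a q f x) (\<lambda>m r. if r = 0 then 0 else stage b q f (prod_encode (x, prod_encode (m, r - 1)))) y"
    obtain u where u: "?r = Suc u" using Suc.prems by (cases ?r) auto
    show ?case using Suc.IH[OF u] Suc.prems u Prec.IH(2) by simp
  qed
  then show ?case using Prec.prems by simp
next
  case (Mu a)
  from stage_MuD[OF Mu.prems] have m: "v < f" "stage a q f (prod_encode (n, v)) = 1"
    "\<And>i. i < v \<Longrightarrow> stage a q f (prod_encode (n, i)) > 1" by auto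
  show ?case
  proof (rule stage_Mu_eqI)
    show "v < f'" using m(1) assms by simp
    show "stage a q f' (prod_encode (n, v)) = 1" using Mu.IH[of _ 0] m(2) by simp
    show "stage a q f' (prod_encode (n, i)) > 1" if "i < v" for i
      using Mu.IH[of "prod_encode (n, i)"] m(3)[OF that]
      by (cases "stage a q f (prod_encode (n, i))") auto
  qed
qed (use assms in \<open>auto split: if_splits\<close>)

lemma stage_complete: "eval q e n v \<Longrightarrow> \<exists>f. stage e q f n = Suc v"
proof (induction rule: eval.induct)
  case (eval_query n)
  then show ?case by (intro exI[of _ "Suc n"]) simp
next
  case (eval_join a n x b y)
  then obtain f f' where "stage a q f n = Suc x" "stage b q f' n = Suc y" by blast
  then have "stage a q (max f f') n = Suc x" "stage b q (max f f') n = Suc y"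
    by (auto intro: stage_mono[rotated])
  then show ?case by (intro exI[of _ "max f f'"]) simp
next
  case (eval_comp b n x a y)
  then obtain f f' where "stage b q f n = Suc x" "stage a q f' x = Suc y" by blast
  then have "stage b q (max f f') n = Suc x" "stage a q (max f f') x = Suc y"
    by (auto intro: stage_mono[rotated])
  then show ?case by (intro exI[of _ "max f f'"]) simp
next
  case (eval_prec_0 a x r b)
  then show ?case by simp
next
  case (eval_prec_Suc a b x m r s)
  then obtain f f' where "stage (Prec a b) q f (prod_encode (x, m)) = Suc r"
    "stage b q f' (prod_encode (x, prod_encode (m, r))) = Suc s" by blast
  then have "stage (Prec a b) q (max f f') (prod_encode (x, m)) = Suc r"
    "stage b q (max f f') (prod_encode (x, prod_encode (m, r))) = Suc s"
    by (auto intro: stage_mono[rotated] simp del: stage.simps)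
  then have "stage (Prec a b) q (max f f') (prod_encode (x, Suc m)) = Suc s"
    by (simp cong: if_cong)
  then show ?case by blast
next
  case (eval_mu a n m)
  obtain f where f: "stage a q f (prod_encode (n, m)) = 1" using eval_mu by auto
  have "\<forall>i<m. \<exists>v f. stage a q f (prod_encode (n, i)) = Suc (Suc v)" using eval_mu by blast
  then obtain g where g: "\<And>i. i < m \<Longrightarrow> \<exists>v. stage a q (g i) (prod_encode (n, i)) = Suc (Suc v)"
    by metis
  \<comment> \<open>The fuel must also exceed \<open>m\<close>, because it bounds the search in
    \<open>Mu\<close>.\<close>
  define F where "F = Suc m + f + sum g {..<m}"
  have le: "g i \<le> F" if "i < m" for i
    using member_le_sum[of i "{..<m}" g] that by (simp add: F_def)
  show ?case
  proof (intro exI[of _ F] stage_Mu_eqI)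
    show "m < F" by (simp add: F_def)
    show "stage a q F (prod_encode (n, m)) = 1"
      using stage_mono[of f F a q _ 0] f by (simp add: F_def)
    show "stage a q F (prod_encode (n, i)) > 1" if "i < m" for i
      using g[OF that] stage_mono[OF le[OF that]] by fastforce
  qed
qed simp_all

text \<open>Only one fixed program is run, so induction on \<open>e\<close> replaces a universal
  program. The oracle may be computed from a parameter, which lets finite trees serve as
  oracles.\<close>

lemma total_rec_stage':
  assumes "total_rec (\<lambda>q z. q' q (code_fst z) (code_snd z))"
  shows "total_rec (\<lambda>q z. stage e (q' q (code_fst z)) (code_fst (code_snd z)) (code_snd (code_snd z)))"
proof (induction e)
  case Query
  have "total_rec (\<lambda>q z. q' q (code_fst z) (code_snd (code_snd z)))"
    by (rule total_rec_comp2[of q']) (intro assms rec_intros)+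
  then show ?case unfolding stage.simps by (intro rec_intros)
next
  case (Join a b)
  then show ?case unfolding stage.simps by (intro rec_intros)
next
  case (Comp a b)
  note a = total_rec_comp3[of "\<lambda>q x f n. stage a (q' q x) f n", OF Comp(1)]
  note b = total_rec_comp3[of "\<lambda>q x f n. stage b (q' q x) f n", OF Comp(2)]
  show ?case unfolding stage.simps by (intro rec_intros a b)
next
  case (Prec a b)
  note a = total_rec_comp3[of "\<lambda>q x f n. stage a (q' q x) f n", OF Prec(1)]
  note b = total_rec_comp3[of "\<lambda>q x f n. stage b (q' q x) f n", OF Prec(2)]
  show ?case unfolding stage.simps by (intro rec_intros a b)
next
  case (Mu a)
  note a = total_rec_comp3[of "\<lambda>q x f n. stage a (q' q x) f n", OF Mu(1)]
  show ?case unfolding stage.simps by (intro rec_intros a)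
qed (simp, intro rec_intros)+

lemma total_rec_stage [rec_intros]:
  assumes "total_rec (\<lambda>q z. q' q (code_fst z) (code_snd z))" "total_rec A" "total_rec B"
  shows "total_rec (\<lambda>q n. stage e (q' q n) (A q n) (B q n))"
  by (rule total_rec_comp3[of "\<lambda>q n. stage e (q' q n)", OF total_rec_stage'[OF assms(1)]])
    (intro assms rec_intros)+

section \<open>Composition of computations and unbounded search\<close>

primrec subst :: "prog \<Rightarrow> prog \<Rightarrow> prog" where
  "subst g Zero = Zero"
| "subst g Succ = Succ"
| "subst g Left = Left"
| "subst g Right = Right"
| "subst g Query = g"
| "subst g (Join a b) = Join (subst g a) (subst g b)"
| "subst g (Comp a b) = Comp (subst g a) (subst g b)"
| "subst g (Prec a b) = Prec (subst g a) (subst g b)"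
| "subst g (Mu a) = Mu (subst g a)"

lemma eval_subst:
  assumes "eval q e n v" "\<And>n. eval p g n (q n)"
  shows "eval p (subst g e) n v"
  using assms(1)
proof (induction rule: eval.induct)
  case (eval_mu a n m)
  then have "eval p (Mu (subst g a)) n m" by (intro eval.eval_mu) blast+
  then show ?case by simp
qed (use assms(2) in \<open>auto intro: eval.intros\<close>)

lemma eval_search:
  assumes "dec (\<lambda>q z. P q (code_fst z) (code_snd z))"
  shows "\<exists>e. \<forall>q n. (\<exists>m. P q n m) \<longrightarrow> eval q e n (LEAST m. P q n m)"
proof -
  have "dec (\<lambda>q z. \<not> P q (code_fst z) (code_snd z))" by (intro rec_intros assms)
  then obtain e where e: "\<And>q z. eval q e z (of_bool (\<not> P q (code_fst z) (code_snd z)))"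
    unfolding total_rec_def by blast
  have "eval q (Mu e) n (LEAST m. P q n m)" if "\<exists>m. P q n m" for q n
  proof (rule eval_mu)
    show "eval q e (prod_encode (n, LEAST m. P q n m)) 0"
      using e[of q "prod_encode (n, LEAST m. P q n m)"] LeastI_ex[OF that] by simp
    show "\<exists>v. eval q e (prod_encode (n, i)) (Suc v)" if "i < (LEAST m. P q n m)" for i
      using e[of q "prod_encode (n, i)"] not_less_Least[OF that] by auto
  qed
  then show ?thesis by blast
qed

section \<open>The binary tree in heap order\<close>

text \<open>
  \<open>Suc m\<close> and \<open>Suc n\<close> are the strings \<open>m\<close> and \<open>n\<close> read as binary numerals with a leading \<open>1\<close>.
\<close>

definition tle :: "nat \<Rightarrow> nat \<Rightarrow> bool" (infix "\<sqsubseteq>" 50) where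
  "m \<sqsubseteq> n \<longleftrightarrow> (\<exists>i<Suc n. Suc n div 2 ^ i = Suc m)"

lemma node_code_Nil: "node_code [] = 0"
  by (simp add: node_code_def)

lemma node_code_append:
  "\<exists>l<2 ^ length \<rho>. Suc (node_code (\<sigma> @ \<rho>)) = Suc (node_code \<sigma>) * 2 ^ length \<rho> + l"
proof (induction \<rho> rule: rev_induct)
  case Nil
  then show ?case by simp
next
  case (snoc b \<rho>)
  then obtain l where l: "l < 2 ^ length \<rho>"
    "Suc (node_code (\<sigma> @ \<rho>)) = Suc (node_code \<sigma>) * 2 ^ length \<rho> + l" by blast
  have "Suc (node_code (\<sigma> @ \<rho> @ [b])) = 2 * Suc (node_code (\<sigma> @ \<rho>)) + of_bool b"
    using node_code_snoc[of "\<sigma> @ \<rho>" b] by simp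
  also have "\<dots> = Suc (node_code \<sigma>) * 2 ^ length (\<rho> @ [b]) + (2 * l + of_bool b)"
    unfolding l(2) by (simp add: algebra_simps)
  finally show ?case
    using l(1) by (intro exI[of _ "2 * l + of_bool b"]) auto
qed

lemma node_code_append_div: "Suc (node_code (\<sigma> @ \<rho>)) div 2 ^ length \<rho> = Suc (node_code \<sigma>)"
proof -
  obtain l where "l < 2 ^ length \<rho>" "Suc (node_code (\<sigma> @ \<rho>)) = Suc (node_code \<sigma>) * 2 ^ length \<rho> + l"
    using node_code_append by blast
  then show ?thesis by (simp only: div_mult_self3 div_less)
qed

lemma tle_node_code: "node_code \<sigma> \<sqsubseteq> node_code \<tau> \<longleftrightarrow> prefix \<sigma> \<tau>"
proof
  assume "prefix \<sigma> \<tau>"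
  then obtain \<rho> where \<rho>: "\<tau> = \<sigma> @ \<rho>" by (auto elim: prefixE)
  \<comment> \<open>The bound on the exponent, which keeps \<open>tle\<close> decidable, is met
    because the length of a suffix stays below the value of the numeral.\<close>
  have "length \<rho> < 2 ^ length \<rho>" by (rule less_exp)
  also have "\<dots> \<le> Suc (node_code \<tau>)" using node_code_append[of \<rho> \<sigma>] \<rho> by auto
  finally show "node_code \<sigma> \<sqsubseteq> node_code \<tau>"
    unfolding tle_def using node_code_append_div[of \<sigma> \<rho>] \<rho> by blast
next
  assume "node_code \<sigma> \<sqsubseteq> node_code \<tau>"
  then obtain i where i: "Suc (node_code \<tau>) div 2 ^ i = Suc (node_code \<sigma>)" unfolding tle_def by blast
  have "i \<le> length \<tau>"
  proof (rule ccontr)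
    assume "\<not> i \<le> length \<tau>"
    then have "(2::nat) ^ Suc (length \<tau>) \<le> 2 ^ i" by (intro power_increasing) auto
    moreover have "Suc (node_code \<tau>) < 2 ^ Suc (length \<tau>)"
      using node_code_append[of \<tau> "[]"] by (auto simp: node_code_def)
    ultimately show False using i by simp
  qed
  then obtain \<tau>' \<rho> where \<tau>: "\<tau> = \<tau>' @ \<rho>" "length \<rho> = i"
    by (metis append_take_drop_id length_drop diff_diff_cancel)
  then have "node_code \<tau>' = node_code \<sigma>" using i node_code_append_div[of \<tau>' \<rho>] by simp
  then have "\<tau>' = \<sigma>" using bij_node_code by (simp add: bij_def inj_eq)
  then show "prefix \<sigma> \<tau>" using \<tau> by simp
qed

lemma node_code_cases: obtains \<sigma> where "n = node_code \<sigma>"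
  using bij_node_code by (metis bij_pointE)

lemma tle_refl [simp, intro]: "m \<sqsubseteq> m"
  by (metis node_code_cases tle_node_code prefix_order.refl)

lemma tle_trans [trans]: "l \<sqsubseteq> m \<Longrightarrow> m \<sqsubseteq> n \<Longrightarrow> l \<sqsubseteq> n"
  by (metis node_code_cases tle_node_code prefix_order.trans)

lemma tle_antisym: "m \<sqsubseteq> n \<Longrightarrow> n \<sqsubseteq> m \<Longrightarrow> m = n"
  by (metis node_code_cases tle_node_code prefix_order.antisym)

lemma tle_linear: "l \<sqsubseteq> n \<Longrightarrow> m \<sqsubseteq> n \<Longrightarrow> l \<sqsubseteq> m \<or> m \<sqsubseteq> l"
  by (metis node_code_cases tle_node_code prefix_same_cases)

lemma tle_child:
  "m \<sqsubseteq> 2 * n + 1 \<longleftrightarrow> m = 2 * n + 1 \<or> m \<sqsubseteq> n"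
  "m \<sqsubseteq> 2 * n + 2 \<longleftrightarrow> m = 2 * n + 2 \<or> m \<sqsubseteq> n"
proof -
  obtain \<sigma> \<tau> where *: "n = node_code \<sigma>" "m = node_code \<tau>" by (metis node_code_cases)
  have "node_code \<tau> \<sqsubseteq> node_code (\<sigma> @ [b]) \<longleftrightarrow> node_code \<tau> = node_code (\<sigma> @ [b]) \<or> node_code \<tau> \<sqsubseteq> node_code \<sigma>" for b
    unfolding tle_node_code prefix_snoc using bij_node_code by (simp add: bij_def inj_eq)
  from this[of False] this[of True] show "m \<sqsubseteq> 2 * n + 1 \<longleftrightarrow> m = 2 * n + 1 \<or> m \<sqsubseteq> n"
    "m \<sqsubseteq> 2 * n + 2 \<longleftrightarrow> m = 2 * n + 2 \<or> m \<sqsubseteq> n"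
    by (simp_all add: node_code_snoc *)
qed

lemma tle_imp_le: "m \<sqsubseteq> n \<Longrightarrow> m \<le> n"
  unfolding tle_def by (metis Suc_le_mono div_le_dividend)

abbreviation incomparable :: "nat \<Rightarrow> nat \<Rightarrow> bool" where
  "incomparable m n \<equiv> \<not> m \<sqsubseteq> n \<and> \<not> n \<sqsubseteq> m"

lemma incomparable_children: "incomparable (2 * n + 1) (2 * n + 2)"
proof -
  have "\<not> 2 * n + 1 \<sqsubseteq> n" "\<not> 2 * n + 2 \<sqsubseteq> n" by (auto dest: tle_imp_le)
  moreover have "2 * n + 1 \<noteq> 2 * n + 2" by simp
  ultimately show ?thesis unfolding tle_child by metis
qed

lemma incomparable_mono: "incomparable a b \<Longrightarrow> a \<sqsubseteq> a' \<Longrightarrow> b \<sqsubseteq> b' \<Longrightarrow> incomparable a' b'"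
  by (meson tle_linear tle_trans)

lemma heap_cases: obtains "n = 0" | p where "n = 2 * p + 1" | p where "n = (2 * p + 2 :: nat)"
proof (cases "n = 0")
  case False
  then show ?thesis using that(2)[of "n div 2"] that(3)[of "n div 2 - 1"]
    by (cases "even n") (auto elim!: evenE oddE)
qed (use that in blast)

lemma incomparable_meet:
  assumes "incomparable m n"
  shows "\<exists>p. 2 * p + 1 \<sqsubseteq> m \<and> 2 * p + 2 \<sqsubseteq> n \<or> 2 * p + 2 \<sqsubseteq> m \<and> 2 * p + 1 \<sqsubseteq> n"
proof -
  obtain \<sigma> \<tau> where *: "m = node_code \<sigma>" "n = node_code \<tau>" by (metis node_code_cases)
  then have "parallel \<sigma> \<tau>" using assms by (auto simp: tle_node_code parallel_def)
  then obtain \<rho> b \<sigma>' c \<tau>' where d: "b \<noteq> c" "\<sigma> = \<rho> @ b # \<sigma>'" "\<tau> = \<rho> @ c # \<tau>'"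
    using parallel_decomp[OF \<open>parallel \<sigma> \<tau>\<close>] by (elim exE conjE) (rule that)
  have "prefix (\<rho> @ [b]) \<sigma>" "prefix (\<rho> @ [c]) \<tau>" using d by auto
  then have "node_code (\<rho> @ [b]) \<sqsubseteq> m" "node_code (\<rho> @ [c]) \<sqsubseteq> n" by (simp_all add: * tle_node_code)
  then show ?thesis using d(1) unfolding node_code_snoc
    by (intro exI[of _ "node_code \<rho>"]) (cases b; cases c; simp)
qed

lemma tle_unbounded: "\<exists>n. m \<sqsubseteq> n \<and> b \<le> n"
proof (induction b)
  case (Suc b)
  then obtain n where "m \<sqsubseteq> n" "b \<le> n" by blast
  then have "m \<sqsubseteq> 2 * n + 1 \<and> Suc b \<le> 2 * n + 1" using tle_child(1) by simp
  then show ?case by blast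
qed auto

definition emb :: "(nat \<Rightarrow> nat) \<Rightarrow> bool" where
  "emb \<phi> \<longleftrightarrow> (\<forall>m n. m \<sqsubseteq> n \<longleftrightarrow> \<phi> m \<sqsubseteq> \<phi> n)"

definition fork :: "(nat \<Rightarrow> nat) \<Rightarrow> nat \<Rightarrow> bool" where
  "fork \<phi> n \<longleftrightarrow> \<phi> n \<sqsubseteq> \<phi> (2 * n + 1) \<and> \<phi> n \<sqsubseteq> \<phi> (2 * n + 2) \<and>
     incomparable (\<phi> (2 * n + 1)) (\<phi> (2 * n + 2))"

lemma emb_comp: "emb \<phi> \<Longrightarrow> emb \<psi> \<Longrightarrow> emb (\<phi> \<circ> \<psi>)"
  by (simp add: emb_def)

lemma emb_id: "emb id"
  by (simp add: emb_def)

lemma emb_inj: "emb \<phi> \<Longrightarrow> inj \<phi>"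
  by (metis emb_def injI tle_antisym tle_refl)

lemma emb_fork: "emb \<phi> \<Longrightarrow> fork \<phi> n"
  unfolding emb_def fork_def using incomparable_children tle_child by (metis tle_refl)

text \<open>Embedding is a local property. Incomparable nodes split at a node \<open>p\<close>; its
  children have incomparable images, and incomparability passes to everything above them. In this
  form finite parts of an embedding can be checked and prolonged.\<close>

lemma embI:
  assumes "\<And>n. fork \<phi> n"
  shows "emb \<phi>"
proof -
  have mono: "\<phi> m \<sqsubseteq> \<phi> n" if "m \<sqsubseteq> n" for m n
    using that
  proof (induction n rule: less_induct)
    case (less n)
    show ?case
    proof (cases n rule: heap_cases)
      case 1
      then show ?thesis using less.prems tle_imp_le by fastforce
    next
      case (2 p)
      then have "m = n \<or> m \<sqsubseteq> p" using less.prems tle_child(1) by simp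
      then show ?thesis using 2 less.IH[of p] assms[of p] by (auto simp: fork_def intro: tle_trans)
    next
      case (3 p)
      then have "m = n \<or> m \<sqsubseteq> p" using less.prems tle_child(2) by simp
      then show ?thesis using 3 less.IH[of p] assms[of p] by (auto simp: fork_def intro: tle_trans)
    qed
  qed
  have strict: "m = n" if "m \<sqsubseteq> n" "\<phi> n \<sqsubseteq> \<phi> m" for m n
    using that
  proof (induction n rule: less_induct)
    case (less n)
    show ?case
    proof (cases n rule: heap_cases)
      case 1
      then show ?thesis using less.prems tle_imp_le by fastforce
    next
      case (2 p)
      \<comment> \<open>Otherwise the image of \<open>n\<close> would lie below that of
        \<open>p\<close>, hence below that of the sibling of \<open>n\<close>.\<close>
      have "False" if "m \<sqsubseteq> p"
      proof -
        have "\<phi> n \<sqsubseteq> \<phi> p" using mono[OF that] less.prems tle_trans by blast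
        then show False using assms[of p] 2 unfolding fork_def by (meson tle_trans)
      qed
      then show ?thesis using 2 less.prems tle_child(1) by metis
    next
      case (3 p)
      have "False" if "m \<sqsubseteq> p"
      proof -
        have "\<phi> n \<sqsubseteq> \<phi> p" using mono[OF that] less.prems tle_trans by blast
        then show False using assms[of p] 3 unfolding fork_def by (meson tle_trans)
      qed
      then show ?thesis using 3 less.prems tle_child(2) by metis
    qed
  qed
  have "m \<sqsubseteq> n" if "\<phi> m \<sqsubseteq> \<phi> n" for m n
  proof (rule ccontr)
    assume n: "\<not> m \<sqsubseteq> n"
    show False
    proof (cases "n \<sqsubseteq> m")
      case True
      then show False using strict[OF True that] n by simp
    next
      case False
      then obtain p where p: "2 * p + 1 \<sqsubseteq> m \<and> 2 * p + 2 \<sqsubseteq> n \<or> 2 * p + 2 \<sqsubseteq> m \<and> 2 * p + 1 \<sqsubseteq> n"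
        using incomparable_meet n by blast
      have f: "incomparable (\<phi> (2 * p + 1)) (\<phi> (2 * p + 2))"
        "incomparable (\<phi> (2 * p + 2)) (\<phi> (2 * p + 1))"
        using assms[of p] unfolding fork_def by auto
      show False
        using p incomparable_mono[OF f(1) mono mono, of m n]
          incomparable_mono[OF f(2) mono mono, of m n] that by blast
    qed
  qed
  then show ?thesis unfolding emb_def using mono by blast
qed

section \<open>Somewhere dense colours\<close>

definition dense_above :: "(nat \<Rightarrow> nat) \<Rightarrow> nat \<Rightarrow> nat \<Rightarrow> bool" where
  "dense_above r i y \<longleftrightarrow> (\<forall>z. y \<sqsubseteq> z \<longrightarrow> (\<exists>w. z \<sqsubseteq> w \<and> r w = i))"

definition dense_colours :: "(nat \<Rightarrow> nat) \<Rightarrow> nat \<Rightarrow> nat set" where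
  "dense_colours r x = {i. \<exists>y. x \<sqsubseteq> y \<and> dense_above r i y}"

lemma dense_coloursI: "x \<sqsubseteq> y \<Longrightarrow> dense_above r i y \<Longrightarrow> i \<in> dense_colours r x"
  by (auto simp: dense_colours_def)

lemma dense_above_mono: "dense_above r i y \<Longrightarrow> y \<sqsubseteq> z \<Longrightarrow> dense_above r i z"
  unfolding dense_above_def using tle_trans by blast

lemma dense_colours_antimono: "x \<sqsubseteq> y \<Longrightarrow> dense_colours r y \<subseteq> dense_colours r x"
  unfolding dense_colours_def using tle_trans by blast

text \<open>Density above \<open>y\<close> is inherited by all nodes above \<open>y\<close>, so one
  can pass to either child of \<open>y\<close> and beyond any bound before meeting colour
  \<open>i\<close> again. The bound \<open>b\<close> will keep new nodes out of reach of a finished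
  computation.\<close>

lemma dense_colours_fork:
  assumes "i \<in> dense_colours r x"
  shows "\<exists>w w'. x \<sqsubseteq> w \<and> x \<sqsubseteq> w' \<and> incomparable w w' \<and> r w = i \<and> r w' = i \<and> b \<le> w \<and> b \<le> w' \<and>
    i \<in> dense_colours r w \<and> i \<in> dense_colours r w'"
proof -
  obtain y where y: "x \<sqsubseteq> y" "dense_above r i y" using assms by (auto simp: dense_colours_def)
  have *: "\<exists>w. c \<sqsubseteq> w \<and> r w = i \<and> b \<le> w \<and> i \<in> dense_colours r w" if "y \<sqsubseteq> c" for c
  proof -
    obtain z where z: "c \<sqsubseteq> z" "b \<le> z" using tle_unbounded by blast
    then obtain w where w: "z \<sqsubseteq> w" "r w = i"
      using y(2) tle_trans[OF \<open>y \<sqsubseteq> c\<close> z(1)] unfolding dense_above_def by blast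
    have "y \<sqsubseteq> w" using that z w tle_trans by blast
    then have "i \<in> dense_colours r w" using y(2) dense_above_mono dense_coloursI tle_refl by blast
    then show ?thesis using z w tle_trans tle_imp_le[OF w(1)] by (metis order_trans)
  qed
  obtain w w' where w: "2 * y + 1 \<sqsubseteq> w" "r w = i" "b \<le> w" "i \<in> dense_colours r w"
    "2 * y + 2 \<sqsubseteq> w'" "r w' = i" "b \<le> w'" "i \<in> dense_colours r w'"
    using *[of "2 * y + 1"] *[of "2 * y + 2"] tle_child by (metis tle_refl)
  moreover have "incomparable w w'" using w(1,5) incomparable_children incomparable_mono by metis
  moreover have "x \<sqsubseteq> w" "x \<sqsubseteq> w'" using w(1,5) y(1) tle_child by (metis tle_refl tle_trans)+
  ultimately show ?thesis by blast
qed

text \<open>In heap order the numbers up to \<open>2 * M\<close> are the root and the children of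
  the nodes below \<open>M\<close>; there \<open>\<phi>\<close> is kept. Beyond, \<open>W\<close>
  produces left and \<open>W'\<close> right children.\<close>

fun grow :: "(nat \<Rightarrow> nat) \<Rightarrow> nat \<Rightarrow> (nat \<Rightarrow> nat) \<Rightarrow> (nat \<Rightarrow> nat) \<Rightarrow> nat \<Rightarrow> nat" where
  "grow \<phi> M W W' n = (if n \<le> 2 * M then \<phi> n
     else if odd n then W (grow \<phi> M W W' ((n - 1) div 2)) else W' (grow \<phi> M W W' ((n - 1) div 2)))"

declare grow.simps [simp del]

text \<open>Every prescribed node still has colour \<open>i\<close> somewhere dense above it, so
  unfinished nodes can be forked forever. All new values are at least \<open>b\<close>, so below
  \<open>b\<close> the range is that of the finite part.\<close>

lemma extend_embedding:
  assumes fork: "\<And>n. n < M \<Longrightarrow> fork \<phi> n"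
    and col: "\<And>m. m \<le> 2 * M \<Longrightarrow> r (\<phi> m) = i"
    and dense: "\<And>m. m \<le> 2 * M \<Longrightarrow> i \<in> dense_colours r (\<phi> m)"
  shows "\<exists>\<psi>. emb \<psi> \<and> (\<forall>m\<le>2 * M. \<psi> m = \<phi> m) \<and> (\<forall>n. r (\<psi> n) = i) \<and> (\<forall>n>2 * M. b \<le> \<psi> n)"
proof -
  obtain W W' where W: "\<And>x. i \<in> dense_colours r x \<Longrightarrow>
      x \<sqsubseteq> W x \<and> x \<sqsubseteq> W' x \<and> incomparable (W x) (W' x) \<and> r (W x) = i \<and> r (W' x) = i \<and>
      b \<le> W x \<and> b \<le> W' x \<and> i \<in> dense_colours r (W x) \<and> i \<in> dense_colours r (W' x)"
  proof -
    have "\<exists>p. i \<in> dense_colours r x \<longrightarrow> x \<sqsubseteq> fst p \<and> x \<sqsubseteq> snd p \<and> incomparable (fst p) (snd p) \<and>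
      r (fst p) = i \<and> r (snd p) = i \<and> b \<le> fst p \<and> b \<le> snd p \<and>
      i \<in> dense_colours r (fst p) \<and> i \<in> dense_colours r (snd p)" for x
      using dense_colours_fork[of i r x b] by auto
    then obtain p where "\<forall>x. i \<in> dense_colours r x \<longrightarrow> x \<sqsubseteq> fst (p x) \<and> x \<sqsubseteq> snd (p x) \<and>
      incomparable (fst (p x)) (snd (p x)) \<and> r (fst (p x)) = i \<and> r (snd (p x)) = i \<and>
      b \<le> fst (p x) \<and> b \<le> snd (p x) \<and>
      i \<in> dense_colours r (fst (p x)) \<and> i \<in> dense_colours r (snd (p x))"
      by (rule choice[THEN exE, OF allI])
    then show thesis using that[of "fst \<circ> p" "snd \<circ> p"] by simp
  qed
  define \<psi> where "\<psi> = grow \<phi> M W W'"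
  have low: "\<psi> n = \<phi> n" if "n \<le> 2 * M" for n using that by (simp add: \<psi>_def grow.simps)
  have high: "\<psi> n = (if odd n then W (\<psi> ((n - 1) div 2)) else W' (\<psi> ((n - 1) div 2)))" if "n > 2 * M" for n
    using that grow.simps[of \<phi> M W W' n] by (simp add: \<psi>_def)
  have inv: "i \<in> dense_colours r (\<psi> n) \<and> r (\<psi> n) = i" for n
  proof (induction n rule: less_induct)
    case (less n)
    show ?case
    proof (cases "n \<le> 2 * M")
      case True
      then show ?thesis using low col dense by simp
    next
      case False
      then have "(n - 1) div 2 < n" by linarith
      from less.IH[OF this] W[of "\<psi> ((n - 1) div 2)"] show ?thesis
        using high[of n] False by simp
    qed
  qed
  have "fork \<psi> n" for n
  proof (cases "n < M")
    case True
    then show ?thesis using fork[OF True] low[of n] low[of "2 * n + 1"] low[of "2 * n + 2"]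
      by (simp add: fork_def)
  next
    case False
    have "\<psi> (2 * n + 1) = W (\<psi> n)" "\<psi> (2 * n + 2) = W' (\<psi> n)"
      using high[of "2 * n + 1"] high[of "2 * n + 2"] False by simp_all
    then show ?thesis using W[of "\<psi> n"] inv[of n] by (simp add: fork_def)
  qed
  then have "emb \<psi>" by (rule embI)
  moreover have "b \<le> \<psi> n" if "n > 2 * M" for n
    using high[OF that] W[of "\<psi> ((n - 1) div 2)"] inv[of "(n - 1) div 2"] by auto
  ultimately show ?thesis using low inv by blast
qed

lemma dense_colours_embedding:
  assumes "i \<in> dense_colours r x"
  shows "\<exists>\<psi>. emb \<psi> \<and> (\<forall>n. r (\<psi> n) = i \<and> x \<sqsubseteq> \<psi> n)"
proof -
  obtain w where w: "x \<sqsubseteq> w" "r w = i" "i \<in> dense_colours r w"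
    using dense_colours_fork[OF assms] by blast
  obtain \<psi> where \<psi>: "emb \<psi>" "\<psi> 0 = w" "\<And>n. r (\<psi> n) = i"
    using extend_embedding[of 0 "\<lambda>_. w" r i 0] w by auto
  have "0 \<sqsubseteq> n" for n
    using tle_node_code[of "[]"] by (metis node_code_cases node_code_Nil prefix_bot.bot_least)
  then have "x \<sqsubseteq> \<psi> n" for n using \<psi> w(1) unfolding emb_def by (metis tle_trans)
  then show ?thesis using \<psi> by blast
qed

section \<open>Colour sets of cones\<close>

definition cone_colours :: "(nat \<Rightarrow> nat) \<Rightarrow> nat \<Rightarrow> nat set" where
  "cone_colours r y = r ` {w. y \<sqsubseteq> w}"

lemma cone_colours_antimono: "x \<sqsubseteq> y \<Longrightarrow> cone_colours r y \<subseteq> cone_colours r x"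
  unfolding cone_colours_def using tle_trans by blast

lemma minimal_cone_colours:
  assumes "\<And>z. y \<sqsubseteq> z \<Longrightarrow> \<not> cone_colours r z \<subset> cone_colours r y"
    and "i \<in> cone_colours r y"
  shows "dense_above r i y"
  unfolding dense_above_def
proof (intro allI impI)
  fix z assume z: "y \<sqsubseteq> z"
  then have "i \<in> cone_colours r z" using assms cone_colours_antimono[OF z] by blast
  then show "\<exists>w. z \<sqsubseteq> w \<and> r w = i" unfolding cone_colours_def by auto
qed

text \<open>A cone above \<open>x\<close> with the fewest colours loses none of them in any smaller
  cone, so each of its colours is dense there.\<close>

lemma dense_colours_nonempty:
  assumes r: "\<And>n. r n < (k::nat)"
  shows "\<exists>i<k. i \<in> dense_colours r x"
proof -
  have fin: "finite (cone_colours r y)" for y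
    by (rule finite_subset[of _ "{..<k}"]) (use r in \<open>auto simp: cone_colours_def\<close>)
  obtain y where y: "x \<sqsubseteq> y" "\<And>z. x \<sqsubseteq> z \<Longrightarrow> card (cone_colours r y) \<le> card (cone_colours r z)"
    using ex_has_least_nat[of "\<lambda>y. x \<sqsubseteq> y" x "\<lambda>y. card (cone_colours r y)"] by auto
  have "\<not> cone_colours r z \<subset> cone_colours r y" if "y \<sqsubseteq> z" for z
    using y(2)[of z] psubset_card_mono[OF fin] y(1) that by (metis not_le tle_trans)
  then have "dense_above r (r y) y"
    using minimal_cone_colours by (auto simp: cone_colours_def)
  then show ?thesis using y(1) r dense_coloursI by blast
qed

lemma homogeneous_embedding:
  assumes "\<And>n. v n < (N::nat)"
  shows "\<exists>\<chi> y. emb \<chi> \<and> y < N \<and> (\<forall>n. v (\<psi> (\<chi> n)) = y)"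
proof -
  obtain y where "y < N" "y \<in> dense_colours (v \<circ> \<psi>) 0"
    using dense_colours_nonempty[of "v \<circ> \<psi>" N] assms by auto
  then show ?thesis using dense_colours_embedding[of y "v \<circ> \<psi>" 0] by fastforce
qed

text \<open>
  Going through the candidates \<open>m\<close> in a fixed order and descending only inside the set of colours of
  the current cone produces a chain of colour sets. True cones of minimal colour set are found by a
  stage that does not depend on \<open>s\<close>; wrong guesses made later can only shrink the colour set further,
  so that the final colour is dense above some node even though the final cone may never stabilize.
\<close>

definition nested_cone :: "(nat \<Rightarrow> nat) \<Rightarrow> nat \<Rightarrow> nat \<Rightarrow> nat \<Rightarrow> nat" where
  "nested_cone r s x n = rec_nat x
     (\<lambda>m c. if x \<sqsubseteq> m \<and> (\<forall>w<s. m \<sqsubseteq> w \<longrightarrow> (\<exists>w'<s. c \<sqsubseteq> w' \<and> r w = r w')) then m else c) n"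

definition pick :: "(nat \<Rightarrow> nat) \<Rightarrow> nat \<Rightarrow> nat \<Rightarrow> nat" where
  "pick r s x = r (nested_cone r s x s)"

lemma pick_dense:
  assumes r: "\<And>n. r n < (k::nat)"
  shows "\<exists>s0. \<forall>s\<ge>s0. pick r s x \<in> dense_colours r x"
proof -
  \<comment> \<open>The colours of the cone of \<open>y\<close> that are visible by stage
    \<open>s\<close>.\<close>
  define Cs where "Cs s y = r ` {w. y \<sqsubseteq> w \<and> w < s}" for s y
  have step: "nested_cone r s x (Suc n) = (if x \<sqsubseteq> n \<and> Cs s n \<subseteq> Cs s (nested_cone r s x n) then n else nested_cone r s x n)" for s n
  proof -
    have "(\<forall>w<s. n \<sqsubseteq> w \<longrightarrow> (\<exists>w'<s. c \<sqsubseteq> w' \<and> r w = r w')) \<longleftrightarrow> Cs s n \<subseteq> Cs s c" for c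
      unfolding Cs_def by blast
    then show ?thesis by (simp add: nested_cone_def)
  qed
  have above: "x \<sqsubseteq> nested_cone r s x n" for s n
    by (induction n) (simp_all add: step, simp add: nested_cone_def)
  have bound: "nested_cone r s x n < max n (Suc x)" for s n
    by (induction n) (auto simp add: step, simp add: nested_cone_def)
  have minimal: "\<not> Cs s y \<subset> Cs s (nested_cone r s x n)" if "y < n" "x \<sqsubseteq> y" for s n y
    using that(1)
  proof (induction n)
    case (Suc n)
    then show ?case using that(2) by (auto simp: step less_Suc_eq)
  qed simp
  have anti: "Cs s (nested_cone r s x n') \<subseteq> Cs s (nested_cone r s x n)" if "n \<le> n'" for s n n'
    using that by (induction n' rule: dec_induct) (auto simp: step)
  \<comment> \<open>There are infinitely many cones but only finitely many colour sets;
    \<open>Y\<close> represents each by a node, and \<open>N\<close> lies beyond all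
    representatives.\<close>
  have fin: "finite (cone_colours r ` {y. x \<sqsubseteq> y})"
    by (rule finite_subset[of _ "Pow {..<k}"]) (use r in \<open>auto simp: cone_colours_def\<close>)
  have "\<exists>y. x \<sqsubseteq> y \<and> cone_colours r y = A" if "A \<in> cone_colours r ` {y. x \<sqsubseteq> y}" for A
    using that by blast
  then obtain Y where Y: "\<And>A. A \<in> cone_colours r ` {y. x \<sqsubseteq> y} \<Longrightarrow> x \<sqsubseteq> Y A \<and> cone_colours r (Y A) = A"
    by metis
  obtain N where N: "\<forall>y\<in>insert x (Y ` (cone_colours r ` {y. x \<sqsubseteq> y})). y < N"
    using fin finite_nat_set_iff_bounded by (metis finite_imageI finite_insert)
  have "\<exists>w. i \<in> cone_colours r y \<longrightarrow> y \<sqsubseteq> w \<and> r w = i" for i y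
    by (auto simp: cone_colours_def)
  then obtain W where W: "\<And>i y. i \<in> cone_colours r y \<Longrightarrow> y \<sqsubseteq> W i y \<and> r (W i y) = i"
    by metis
  have "finite ((\<lambda>(i, y). W i y) ` ({..<k} \<times> {..N}))" by simp
  then obtain s1 where "\<forall>w\<in>(\<lambda>(i, y). W i y) ` ({..<k} \<times> {..N}). w < s1"
    using finite_nat_set_iff_bounded by blast
  then have s1: "\<And>i y. i < k \<Longrightarrow> y \<le> N \<Longrightarrow> W i y < s1" by auto
  have Cs_eq: "Cs s y = cone_colours r y" if "s \<ge> s1" "y \<le> N" for s y
  proof
    show "cone_colours r y \<subseteq> Cs s y"
    proof
      fix i assume i: "i \<in> cone_colours r y"
      then have "i < k" using r by (auto simp: cone_colours_def)
      then have "W i y < s" using s1[of i y] that by simp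
      then show "i \<in> Cs s y"
        using W[OF i] unfolding Cs_def by (intro image_eqI[of _ _ "W i y"]) auto
    qed
  qed (auto simp: Cs_def cone_colours_def)
  have "pick r s x \<in> dense_colours r x" if s: "s \<ge> max s1 N" for s
  proof -
    \<comment> \<open>The first \<open>N\<close> candidates include a representative of each colour
      set, so \<open>c\<close> has a minimal one; later moves stay within the visible colours of
      \<open>c\<close>.\<close>
    define c where "c = nested_cone r s x N"
    have "x < N" using N by simp
    then have cN: "c \<le> N" using bound[of s N] by (simp add: c_def)
    have xc: "x \<sqsubseteq> c" using above by (simp add: c_def)
    have min: "\<not> cone_colours r z \<subset> cone_colours r c" if "c \<sqsubseteq> z" for z
    proof -
      have z: "cone_colours r z \<in> cone_colours r ` {y. x \<sqsubseteq> y}" using that xc tle_trans by blast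
      let ?y = "Y (cone_colours r z)"
      have y: "x \<sqsubseteq> ?y" "cone_colours r ?y = cone_colours r z" "?y < N" using Y[OF z] N z by auto
      then show ?thesis using minimal[OF y(3,1), of s] Cs_eq s cN by (simp flip: c_def)
    qed
    let ?f = "nested_cone r s x s"
    have "?f < s" using bound[of s s] \<open>x < N\<close> s by simp
    then have "r ?f \<in> Cs s ?f" by (auto simp: Cs_def)
    then have "r ?f \<in> cone_colours r c"
      using anti[of N s s] s Cs_eq[of s c] cN by (auto simp flip: c_def)
    then show ?thesis
      unfolding pick_def using minimal_cone_colours[OF min] dense_coloursI[OF xc] by blast
  qed
  then show ?thesis by blast
qed

section \<open>Finite approximations of monochromatic trees\<close>

definition digit :: "nat \<Rightarrow> nat \<Rightarrow> nat \<Rightarrow> nat" where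
  "digit w b m = w div b ^ m mod b"

lemma digit_less: "b > 0 \<Longrightarrow> digit w b m < b"
  by (simp add: digit_def)

text \<open>The bound \<open>b ^ n\<close> turns quantifiers over labellings and assignments into
  bounded ones.\<close>

lemma digits_exist:
  assumes "\<And>m. m < n \<Longrightarrow> f m < (b::nat)"
  shows "\<exists>w<b ^ n. \<forall>m<n. digit w b m = f m"
  using assms
proof (induction n)
  case (Suc n)
  then obtain w where w: "w < b ^ n" "\<forall>m<n. digit w b m = f m" by auto
  have f: "f n < b" using Suc.prems by simp
  have "digit (w + f n * b ^ n) b m = f m" if "m < Suc n" for m
  proof (cases "m = n")
    case True
    then show ?thesis using w(1) f by (simp add: digit_def)
  next
    case False
    then have m: "m < n" using that by simp
    have "b ^ n = b ^ m * b * b ^ (n - Suc m)"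
      using m by (metis Suc_leI le_add_diff_inverse power_Suc2 power_add)
    then have "w + f n * b ^ n = w + (b * (f n * b ^ (n - Suc m))) * b ^ m" by (simp only: ac_simps)
    then have "(w + f n * b ^ n) div b ^ m = b * (f n * b ^ (n - Suc m)) + w div b ^ m"
      using f by (simp only:) simp
    then have "digit (w + f n * b ^ n) b m = digit w b m" by (simp add: digit_def)
    then show ?thesis using w(2) m by simp
  qed
  moreover have "w + f n * b ^ n < b ^ Suc n"
  proof -
    have "w + f n * b ^ n < Suc (f n) * b ^ n" using w(1) by simp
    also have "\<dots> \<le> b * b ^ n" using f by (intro mult_right_mono) auto
    finally show ?thesis by simp
  qed
  ultimately show ?case by blast
qed simp

text \<open>A code is \<open>(M, (f, (b, w)))\<close>: \<open>M\<close> counts the nodes required to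
  fork, so the tree is given on the numbers up to \<open>2 * M\<close>; \<open>f\<close> is the
  fuel; the nodes are the base \<open>b\<close> digits of \<open>w\<close>.\<close>

definition tree_height :: "nat \<Rightarrow> nat" where "tree_height x = code_fst x"
definition tree_fuel :: "nat \<Rightarrow> nat" where "tree_fuel x = code_fst (code_snd x)"
definition tree_node :: "nat \<Rightarrow> nat \<Rightarrow> nat" where
  "tree_node x m = digit (code_snd (code_snd (code_snd x))) (code_fst (code_snd (code_snd x))) m"

lemma tree_code_exists:
  "\<exists>x. tree_height x = M \<and> tree_fuel x = f \<and> (\<forall>m\<le>2 * M. tree_node x m = \<phi> m)"
proof -
  have "finite (\<phi> ` {..2 * M})" by simp
  then obtain b where "\<forall>v\<in>\<phi> ` {..2 * M}. v < b" using finite_nat_set_iff_bounded by blast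
  then have "\<And>m. m < Suc (2 * M) \<Longrightarrow> \<phi> m < b" by simp
  from digits_exist[of "Suc (2 * M)" \<phi>, OF this] obtain w where "\<forall>m<Suc (2 * M). digit w b m = \<phi> m" by blast
  then show ?thesis
    by (intro exI[of _ "prod_encode (M, prod_encode (f, prod_encode (b, w)))"])
      (simp add: tree_height_def tree_fuel_def tree_node_def less_Suc_eq_le)
qed

text \<open>A cluster point in the compact space of labellings: repeated pigeonhole extends an
  initial segment shared by infinitely many \<open>v n\<close>.\<close>

lemma colouring_compactness:
  fixes v :: "nat \<Rightarrow> nat \<Rightarrow> nat"
  assumes v: "\<And>n t. v n t < M"
  shows "\<exists>u. (\<forall>t. u t < M) \<and> (\<forall>n. \<exists>n'\<ge>n. \<forall>t<n. v n' t = u t)"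
proof -
  define P where "P m l \<longleftrightarrow> length l = m \<and> infinite {n. \<forall>t<m. v n t = l ! t}" for m and l :: "nat list"
  have "\<exists>L. \<forall>m. P m (L m) \<and> (\<exists>y. L (Suc m) = L m @ [y])"
  proof (rule dependent_nat_choice)
    show "\<exists>l. P 0 l" by (simp add: P_def)
    fix l m assume l: "P m l"
    let ?A = "{n. \<forall>t<m. v n t = l ! t}"
    have "finite ((\<lambda>n. v n m) ` ?A)"
      by (rule finite_subset[of _ "{..<M}"]) (use v in auto)
    then obtain n0 where "infinite {n \<in> ?A. v n m = v n0 m}"
      using pigeonhole_infinite[of ?A "\<lambda>n. v n m"] l by (auto simp: P_def)
    moreover have "{n \<in> ?A. v n m = v n0 m} = {n. \<forall>t<Suc m. v n t = (l @ [v n0 m]) ! t}"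
      using l by (auto simp: P_def nth_append less_Suc_eq)
    ultimately have "P (Suc m) (l @ [v n0 m])" using l by (simp add: P_def)
    then show "\<exists>l'. P (Suc m) l' \<and> (\<exists>y. l' = l @ [y])" by blast
  qed
  then obtain L where L: "\<And>m. P m (L m)" "\<And>m. \<exists>y. L (Suc m) = L m @ [y]" by blast
  define u where "u t = L (Suc t) ! t" for t
  have Lu: "L m ! t = u t" if "t < m" for m t
    using that
  proof (induction m)
    case (Suc m)
    obtain y where y: "L (Suc m) = L m @ [y]" using L(2) by blast
    have "length (L m) = m" using L(1)[of m] by (simp add: P_def)
    then show ?case using Suc y by (cases "t = m") (auto simp: nth_append u_def)
  qed simp
  have u: "\<exists>n'\<ge>n. \<forall>t<n. v n' t = u t" for n
  proof -
    have "infinite {n'. \<forall>t<n. v n' t = L n ! t}" using L(1)[of n] by (simp add: P_def)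
    then obtain n' where "n' > n" "\<forall>t<n. v n' t = L n ! t"
      unfolding finite_nat_set_iff_bounded_le by (auto simp: not_le)
    then show ?thesis using Lu by (metis less_imp_le)
  qed
  have "u t < M" for t using u[of "Suc t"] v by (metis lessI)
  then show ?thesis using u by blast
qed

text \<open>
  Here \<open>r\<close> is a colouring of the nodes, and \<open>V X f\<close> is the answer (shifted by one, \<open>0\<close> meaning no answer)
  computed with fuel \<open>f\<close> from a set with characteristic function \<open>X\<close>.
\<close>

definition finite_solution :: "(nat \<Rightarrow> nat) \<Rightarrow> (baire \<Rightarrow> nat \<Rightarrow> nat) \<Rightarrow> nat \<Rightarrow> nat \<Rightarrow> nat \<Rightarrow> bool" where
  "finite_solution r V x i b \<longleftrightarrow>
     (\<forall>m<Suc (2 * tree_height x). r (tree_node x m) = i) \<and>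
     (\<forall>n<tree_height x. fork (tree_node x) n) \<and>
     V (\<lambda>n. of_bool (\<exists>m<Suc (2 * tree_height x). tree_node x m = n)) (tree_fuel x) = Suc b"

text \<open>
  An assignment \<open>a\<close> promises the answer \<open>a i - 1\<close> for each colour \<open>i\<close> with \<open>a i \<noteq> 0\<close>. A set \<open>Y\<close> is large if,
  however its elements are labelled by assigned colours, some assigned colour \<open>i\<close> has a finite solution
  with the promised answer, each node of which lies below an element of \<open>Y\<close> labelled \<open>i\<close>. The first
  component of the label, with \<open>M\<close> values, makes largeness survive partitions of \<open>Y\<close> into few pieces.
\<close>

definition admissible :: "nat \<Rightarrow> nat set \<Rightarrow> (nat \<Rightarrow> nat) \<Rightarrow> nat \<Rightarrow> (nat \<Rightarrow> nat \<times> nat) \<Rightarrow> bool" where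
  "admissible k Y a M u \<longleftrightarrow> (\<forall>t\<in>Y. fst (u t) < M \<and> snd (u t) < k \<and> a (snd (u t)) \<noteq> 0)"

definition hits :: "(nat \<Rightarrow> nat) \<Rightarrow> (baire \<Rightarrow> nat \<Rightarrow> nat) \<Rightarrow> nat \<Rightarrow> nat set \<Rightarrow> (nat \<Rightarrow> nat) \<Rightarrow> (nat \<Rightarrow> nat \<times> nat) \<Rightarrow> bool" where
  "hits r V n Y a u \<longleftrightarrow> (\<exists>z i x. x < n \<and> a i \<noteq> 0 \<and> finite_solution r V x i (a i - 1) \<and>
     (\<forall>m<Suc (2 * tree_height x). \<exists>t\<in>Y. tree_node x m \<sqsubseteq> t \<and> u t = (z, i)))"

definition large :: "(nat \<Rightarrow> nat) \<Rightarrow> (baire \<Rightarrow> nat \<Rightarrow> nat) \<Rightarrow> nat \<Rightarrow> nat \<Rightarrow> nat set \<Rightarrow> (nat \<Rightarrow> nat) \<Rightarrow> nat \<Rightarrow> bool" where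
  "large r V k n Y a M \<longleftrightarrow> (\<forall>u. admissible k Y a M u \<longrightarrow> hits r V n Y a u)"

lemma hitsI:
  assumes "x < n" "a i \<noteq> 0" "finite_solution r V x i (a i - 1)"
    "\<And>m. m < Suc (2 * tree_height x) \<Longrightarrow> \<exists>t\<in>Y. tree_node x m \<sqsubseteq> t \<and> u t = (z, i)"
  shows "hits r V n Y a u"
  unfolding hits_def using assms by blast

lemma largeD:
  assumes "large r V k n Y a M"
    and "\<And>t. t \<in> Y \<Longrightarrow> fst (u t) < M \<and> snd (u t) < k \<and> a (snd (u t)) \<noteq> 0"
  obtains x i z where "x < n" "a i \<noteq> 0" "finite_solution r V x i (a i - 1)"
    "\<forall>m<Suc (2 * tree_height x). \<exists>t\<in>Y. tree_node x m \<sqsubseteq> t \<and> u t = (z, i)"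
proof -
  have "hits r V n Y a u"
    using assms unfolding large_def admissible_def by blast
  then obtain z i x where "x < n" "a i \<noteq> 0" "finite_solution r V x i (a i - 1)"
    "\<forall>m<Suc (2 * tree_height x). \<exists>t\<in>Y. tree_node x m \<sqsubseteq> t \<and> u t = (z, i)"
    unfolding hits_def by blast
  then show thesis by (rule that)
qed

lemma large_mono:
  assumes "large r V k n Y a M" "n \<le> n'" "Y \<subseteq> Y'" "M' \<le> M"
  shows "large r V k n' Y' a M'"
  unfolding large_def
proof (intro allI impI)
  fix u assume "admissible k Y' a M' u"
  then have u: "\<forall>t\<in>Y'. fst (u t) < M' \<and> snd (u t) < k \<and> a (snd (u t)) \<noteq> 0"
    by (simp add: admissible_def)
  have "fst (u t) < M \<and> snd (u t) < k \<and> a (snd (u t)) \<noteq> 0" if "t \<in> Y" for t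
    using u that assms(3,4) by (meson less_le_trans subsetD)
  note u' = this
  obtain x i z where x: "x < n" "a i \<noteq> 0" "finite_solution r V x i (a i - 1)"
    "\<And>m. m < Suc (2 * tree_height x) \<Longrightarrow> \<exists>t\<in>Y. tree_node x m \<sqsubseteq> t \<and> u t = (z, i)"
      by (rule largeD[where u = u, OF assms(1) u']) auto
  then have "\<exists>t\<in>Y'. tree_node x m \<sqsubseteq> t \<and> u t = (z, i)" if "m < Suc (2 * tree_height x)" for m
    using that assms(3) by blast
  then show "hits r V n' Y' a u"
    using x(1-3) assms(2) by (intro hitsI[of x]) auto
qed

lemma large_cong:
  assumes "large r V k n Y a M" "\<And>i. i < k \<Longrightarrow> a i = a' i"
  shows "large r V k n Y a' M"
  unfolding large_def
proof (intro allI impI)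
  fix u assume "admissible k Y a' M u"
  then have u: "\<forall>t\<in>Y. fst (u t) < M \<and> snd (u t) < k \<and> a' (snd (u t)) \<noteq> 0"
    by (simp add: admissible_def)
  then have "fst (u t) < M \<and> snd (u t) < k \<and> a (snd (u t)) \<noteq> 0" if "t \<in> Y" for t
    using that assms(2) by auto
  note u' = this
  obtain x i z where x: "x < n" "a i \<noteq> 0" "finite_solution r V x i (a i - 1)"
    "\<And>m. m < Suc (2 * tree_height x) \<Longrightarrow> \<exists>t\<in>Y. tree_node x m \<sqsubseteq> t \<and> u t = (z, i)"
      by (rule largeD[where u = u, OF assms(1) u']) auto
  \<comment> \<open>Every tree contains node number 0, so the label \<open>i\<close> really occurs
    on \<open>Y\<close> and is below \<open>k\<close>.\<close>
  obtain t where "t \<in> Y" "u t = (z, i)" using x(4)[of 0] by auto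
  then have "i < k" using u by force
  then show "hits r V n Y a' u"
    using x assms(2)[of i] by (intro hitsI[of x _ _ i]) auto
qed

text \<open>If every piece had a bad labelling, tagging each with the index of its piece would give
  a bad labelling of \<open>Y\<close>: all witnesses for a tree carry the same tag and so lie in one
  piece.\<close>

lemma large_partition:
  assumes L: "large r V k n Y a (M * N)" and v: "\<And>t. v t < N"
  shows "\<exists>y<N. large r V k n {t \<in> Y. v t = y} a M"
proof (rule ccontr)
  assume "\<not> ?thesis"
  then have "\<forall>y. \<exists>u. y < N \<longrightarrow> admissible k {t \<in> Y. v t = y} a M u \<and> \<not> hits r V n {t \<in> Y. v t = y} a u"
    unfolding large_def by blast
  from choice[OF this] obtain U where U: "\<And>y. y < N \<Longrightarrow> admissible k {t \<in> Y. v t = y} a M (U y)"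
    "\<And>y. y < N \<Longrightarrow> \<not> hits r V n {t \<in> Y. v t = y} a (U y)"
    by auto
  \<comment> \<open>Piece and label are packed as quotient and remainder modulo \<open>M\<close>,
    hence the factor \<open>N\<close> in the hypothesis.\<close>
  define u where "u t = (v t * M + fst (U (v t) t), snd (U (v t) t))" for t
  have *: "fst (U (v t) t) < M \<and> snd (U (v t) t) < k \<and> a (snd (U (v t) t)) \<noteq> 0" if "t \<in> Y" for t
    using U(1)[OF v[of t]] that unfolding admissible_def by blast
  have "fst (u t) < M * N \<and> snd (u t) < k \<and> a (snd (u t)) \<noteq> 0" if "t \<in> Y" for t
  proof -
    have "v t * M + fst (U (v t) t) < Suc (v t) * M" using *[OF that] by simp
    also have "\<dots> \<le> N * M" using v[of t] by (intro mult_right_mono) auto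
    finally show ?thesis using *[OF that] by (simp add: u_def mult.commute)
  qed
  note u' = this
  obtain x i z where x: "x < n" "a i \<noteq> 0" "finite_solution r V x i (a i - 1)"
    "\<And>m. m < Suc (2 * tree_height x) \<Longrightarrow> \<exists>t\<in>Y. tree_node x m \<sqsubseteq> t \<and> u t = (z, i)"
      by (rule largeD[where u = u, OF L u']) auto
  have t: "v t = z div M \<and> U (z div M) t = (z mod M, i)" if "t \<in> Y" "u t = (z, i)" for t
  proof -
    have z: "z = v t * M + fst (U (v t) t)" and i: "snd (U (v t) t) = i" using that by (auto simp: u_def)
    have "z div M = v t" "z mod M = fst (U (v t) t)" unfolding z using *[OF that(1)] by simp_all
    then show ?thesis using i by (metis prod.collapse)
  qed
  have "z div M < N" using x(4)[of 0] t v by (metis zero_less_Suc)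
  moreover have "hits r V n {t \<in> Y. v t = z div M} a (U (z div M))"
  proof (rule hitsI[of x n a i, OF x(1-3)])
    fix m assume "m < Suc (2 * tree_height x)"
    then show "\<exists>t\<in>{t \<in> Y. v t = z div M}. tree_node x m \<sqsubseteq> t \<and> U (z div M) t = (z mod M, i)"
      using x(4) t by blast
  qed
  ultimately show False using U(2) by blast
qed

text \<open>Given a labelling, either some \<open>\<tau>\<close> has only colour \<open>i\<close>
  above it, up to its bound, and a tree with the new answer is hit there, or every
  \<open>\<tau>\<close> has a node above it with another label; these labels, moved down to
  \<open>Y\<close>, are admissible for the old assignment.\<close>

lemma large_extend:
  assumes L: "large r V k n Y a M" and Y: "Y \<subseteq> {..<n}" and i: "a i = 0"
    and ex: "\<And>\<tau>. \<tau> \<in> Y \<Longrightarrow> \<exists>n. large r V k n {t. \<tau> \<sqsubseteq> t \<and> t < n} (\<lambda>i'. if i' = i then Suc b else 0) M"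
  shows "\<exists>n. large r V k n {..<n} (a(i := Suc b)) M"
proof -
  obtain N where N: "\<And>\<tau>. \<tau> \<in> Y \<Longrightarrow> large r V k (N \<tau>) {t. \<tau> \<sqsubseteq> t \<and> t < N \<tau>} (\<lambda>i'. if i' = i then Suc b else 0) M"
    using ex by metis
  have fin: "finite Y" using Y finite_subset by blast
  define n' where "n' = n + sum N Y"
  have le: "N \<tau> \<le> n'" if "\<tau> \<in> Y" for \<tau>
    using member_le_sum[OF that, of N] fin by (simp add: n'_def)
  have "large r V k n' {..<n'} (a(i := Suc b)) M"
    unfolding large_def
  proof (intro allI impI)
    fix u assume "admissible k {..<n'} (a(i := Suc b)) M u"
    then have u: "\<forall>t\<in>{..<n'}. fst (u t) < M \<and> snd (u t) < k \<and> (a(i := Suc b)) (snd (u t)) \<noteq> 0"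
      by (simp only: admissible_def)
    show "hits r V n' {..<n'} (a(i := Suc b)) u"
    proof (cases "\<exists>\<tau>\<in>Y. \<forall>t. \<tau> \<sqsubseteq> t \<and> t < N \<tau> \<longrightarrow> snd (u t) = i")
      case True
      then obtain \<tau> where \<tau>: "\<tau> \<in> Y" "\<And>t. \<tau> \<sqsubseteq> t \<Longrightarrow> t < N \<tau> \<Longrightarrow> snd (u t) = i" by blast
      have "fst (u t) < M \<and> snd (u t) < k \<and> (if snd (u t) = i then Suc b else 0) \<noteq> 0"
        if "t \<in> {t. \<tau> \<sqsubseteq> t \<and> t < N \<tau>}" for t
        using u \<tau>(2)[of t] that le[OF \<tau>(1)] by auto
      note u' = this
  obtain x i' z where x: "x < N \<tau>" "(if i' = i then Suc b else 0) \<noteq> 0"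
        "finite_solution r V x i' ((if i' = i then Suc b else 0) - 1)"
        "\<And>m. m < Suc (2 * tree_height x) \<Longrightarrow> \<exists>t\<in>{t. \<tau> \<sqsubseteq> t \<and> t < N \<tau>}. tree_node x m \<sqsubseteq> t \<and> u t = (z, i')"
      by (rule largeD[where u = u, OF N[OF \<tau>(1)] u']) auto
      have "i' = i" using x(2) by (auto split: if_splits)
      moreover have "\<exists>t\<in>{..<n'}. tree_node x m \<sqsubseteq> t \<and> u t = (z, i')" if "m < Suc (2 * tree_height x)" for m
        using x(4)[OF that] le[OF \<tau>(1)] by auto
      ultimately show ?thesis using x(1,3) le[OF \<tau>(1)]
        by (intro hitsI[of x _ _ i]) auto
    next
      case False
      then obtain T where T: "\<And>\<tau>. \<tau> \<in> Y \<Longrightarrow> \<tau> \<sqsubseteq> T \<tau> \<and> T \<tau> < N \<tau> \<and> snd (u (T \<tau>)) \<noteq> i" by metis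
      then have T': "T \<tau> < n'" if "\<tau> \<in> Y" for \<tau> using le that less_le_trans by blast
      have "fst (u (T \<tau>)) < M \<and> snd (u (T \<tau>)) < k \<and> a (snd (u (T \<tau>))) \<noteq> 0" if "\<tau> \<in> Y" for \<tau>
        using u[rule_format, of "T \<tau>"] T[OF that] T'[OF that] by simp
      note u' = this
  obtain x i' z where x: "x < n" "a i' \<noteq> 0" "finite_solution r V x i' (a i' - 1)"
        "\<And>m. m < Suc (2 * tree_height x) \<Longrightarrow> \<exists>t\<in>Y. tree_node x m \<sqsubseteq> t \<and> u (T t) = (z, i')"
      by (rule largeD[where u = "\<lambda>\<tau>. u (T \<tau>)", OF L u']) auto
      have "\<exists>t\<in>{..<n'}. tree_node x m \<sqsubseteq> t \<and> u t = (z, i')" if m: "m < Suc (2 * tree_height x)" for m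
      proof -
        obtain t where t: "t \<in> Y" "tree_node x m \<sqsubseteq> t" "u (T t) = (z, i')" using x(4)[OF m] by blast
        then have "tree_node x m \<sqsubseteq> T t" using T tle_trans by blast
        then show ?thesis using t T' by blast
      qed
      moreover have "i' \<noteq> i" using x(2) i by auto
      moreover have "x < n'" using x(1) by (simp add: n'_def)
      ultimately show ?thesis using x(2,3)
        by (intro hitsI[of x _ _ i']) auto
    qed
  qed
  then show ?thesis by blast
qed

text \<open>\<open>G\<close> is the solution set of one instance of the competing problem,
  \<open>r\<close> the colouring computed from it and \<open>V\<close> the backward functional with
  fuel. Correct answers are assumed only on full monochromatic copies, to which finite trees have to
  be related.\<close>

locale tree_answers =
  fixes r :: "nat \<Rightarrow> nat" and V :: "baire \<Rightarrow> nat \<Rightarrow> nat" and k j :: nat and G :: "nat set"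
  assumes colour_less: "\<And>n. r n < k"
    and V_local: "\<And>f q q'. (\<And>n. n < f \<Longrightarrow> q n = q' n) \<Longrightarrow> V q f = V q' f"
    and V_mono: "\<And>f f' q b. f \<le> f' \<Longrightarrow> V q f = Suc b \<Longrightarrow> V q f' = Suc b"
    and V_answer: "\<And>\<psi> i. emb \<psi> \<Longrightarrow> (\<And>n. r (\<psi> n) = i) \<Longrightarrow>
      \<exists>f b. V (\<lambda>n. of_bool (n \<in> range \<psi>)) f = Suc b \<and> b \<in> G"
    and answers_less: "\<And>b. b \<in> G \<Longrightarrow> b < j"
begin

text \<open>Completed by nodes beyond its fuel, the finite tree becomes a full copy that the
  computation cannot tell apart from it, and the answer on the full copy is correct.\<close>

lemma finite_solution_correct:
  assumes x: "finite_solution r V x i b"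
    and dense: "\<And>m. m < Suc (2 * tree_height x) \<Longrightarrow> i \<in> dense_colours r (tree_node x m)"
  shows "b \<in> G"
proof -
  let ?M = "tree_height x"
  obtain \<psi> where \<psi>: "emb \<psi>" "\<And>m. m \<le> 2 * ?M \<Longrightarrow> \<psi> m = tree_node x m" "\<And>n. r (\<psi> n) = i"
    "\<And>n. n > 2 * ?M \<Longrightarrow> tree_fuel x \<le> \<psi> n"
    using extend_embedding[of ?M "tree_node x" r i "tree_fuel x"] x dense
    unfolding finite_solution_def less_Suc_eq_le by blast
  obtain f b' where f: "V (\<lambda>n. of_bool (n \<in> range \<psi>)) f = Suc b'" "b' \<in> G"
    using V_answer \<psi>(1,3) by blast
  have eq: "(\<exists>m<Suc (2 * ?M). tree_node x m = n) \<longleftrightarrow> n \<in> range \<psi>" if "n < tree_fuel x" for n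
  proof
    assume "n \<in> range \<psi>"
    then obtain m where m: "n = \<psi> m" by blast
    then have "m \<le> 2 * ?M" using \<psi>(4)[of m] that by (meson not_le)
    then show "\<exists>m<Suc (2 * ?M). tree_node x m = n" using m \<psi>(2) by (auto simp: less_Suc_eq_le)
  next
    assume "\<exists>m<Suc (2 * ?M). tree_node x m = n"
    then show "n \<in> range \<psi>" using \<psi>(2) by (metis less_Suc_eq_le rangeI)
  qed
  have "V (\<lambda>n. of_bool (n \<in> range \<psi>)) (tree_fuel x) =
      V (\<lambda>n. of_bool (\<exists>m<Suc (2 * ?M). tree_node x m = n)) (tree_fuel x)"
    by (rule V_local) (simp only: eq)
  then have "V (\<lambda>n. of_bool (n \<in> range \<psi>)) (tree_fuel x) = Suc b"
    using x unfolding finite_solution_def by simp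
  then have "V (\<lambda>n. of_bool (n \<in> range \<psi>)) (max f (tree_fuel x)) = Suc b"
    "V (\<lambda>n. of_bool (n \<in> range \<psi>)) (max f (tree_fuel x)) = Suc b'"
    using f(1) V_mono by (meson max.cobounded1 max.cobounded2)+
  then show ?thesis using f(2) by simp
qed

lemma finite_solution_exists:
  assumes \<psi>: "emb \<psi>" "\<And>n. r (\<psi> n) = i"
  shows "\<exists>x b. finite_solution r V x i b \<and> b < j \<and> (\<forall>m<Suc (2 * tree_height x). tree_node x m \<in> range \<psi>)"
proof -
  obtain f b where f: "V (\<lambda>n. of_bool (n \<in> range \<psi>)) f = Suc b" "b \<in> G"
    using V_answer \<psi> by blast
  have "\<exists>l. n \<in> range \<psi> \<longrightarrow> n = \<psi> l" for n by auto
  then obtain l where l: "\<And>n. n \<in> range \<psi> \<Longrightarrow> n = \<psi> (l n)" by metis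
  \<comment> \<open>\<open>M\<close> bounds preimages of all range nodes below the fuel, so the
    finite part misses no node that can be queried.\<close>
  define M where "M = sum l {..<f}"
  have lM: "l n \<le> 2 * M" if "n < f" for n
    using member_le_sum[of n "{..<f}" l] that by (simp add: M_def)
  obtain x where x: "tree_height x = M" "tree_fuel x = f" "\<And>m. m \<le> 2 * M \<Longrightarrow> tree_node x m = \<psi> m"
    using tree_code_exists by blast
  have eq: "(\<exists>m<Suc (2 * M). tree_node x m = n) \<longleftrightarrow> n \<in> range \<psi>" if "n < f" for n
  proof
    assume "n \<in> range \<psi>"
    then show "\<exists>m<Suc (2 * M). tree_node x m = n" using l lM[OF that] x(3) by (metis less_Suc_eq_le)
  qed (use x(3) in \<open>auto simp: less_Suc_eq_le\<close>)
  have "V (\<lambda>n. of_bool (\<exists>m<Suc (2 * M). tree_node x m = n)) f = V (\<lambda>n. of_bool (n \<in> range \<psi>)) f"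
    by (rule V_local) (simp only: eq)
  then have "V (\<lambda>n. of_bool (\<exists>m<Suc (2 * M). tree_node x m = n)) f = Suc b"
    using f(1) by simp
  moreover have "fork (tree_node x) n" if "n < M" for n
    using emb_fork[OF \<psi>(1), of n] x(3)[of n] x(3)[of "2 * n + 1"] x(3)[of "2 * n + 2"] that
    by (simp add: fork_def)
  ultimately have "finite_solution r V x i b"
    unfolding finite_solution_def using x \<psi>(2) by (simp add: less_Suc_eq_le)
  moreover have "\<forall>m<Suc (2 * tree_height x). tree_node x m \<in> range \<psi>"
    using x(1,3) by (simp add: less_Suc_eq_le)
  ultimately show ?thesis using f(2) answers_less by blast
qed

text \<open>
  Passing to a subtree whose set of possible answers is minimal, every answer left occurs in every
  further subtree.
\<close>

lemma persistent_answer: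
  assumes \<psi>: "emb \<psi>" "\<And>n. r (\<psi> n) = i"
  shows "\<exists>\<chi> b. emb \<chi> \<and> b < j \<and> (\<forall>\<omega>. emb \<omega> \<longrightarrow>
    (\<exists>x. finite_solution r V x i b \<and>
      (\<forall>m<Suc (2 * tree_height x). tree_node x m \<in> range (\<psi> \<circ> \<chi> \<circ> \<omega>))))"
proof -
  define B where "B \<chi> = {b. b < j \<and> (\<exists>x. finite_solution r V x i b \<and>
      (\<forall>m<Suc (2 * tree_height x). tree_node x m \<in> range (\<psi> \<circ> \<chi>)))}" for \<chi> :: "nat \<Rightarrow> nat"
  have fin: "finite (B \<chi>)" for \<chi> by (rule finite_subset[of _ "{..<j}"]) (auto simp: B_def)
  obtain \<chi> where \<chi>: "emb \<chi>" "\<And>\<chi>'. emb \<chi>' \<Longrightarrow> card (B \<chi>) \<le> card (B \<chi>')"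
    using ex_has_least_nat[of emb id "\<lambda>\<chi>. card (B \<chi>)"] emb_id by auto
  have "emb (\<psi> \<circ> \<chi>)" using emb_comp \<psi>(1) \<chi>(1) by blast
  from finite_solution_exists[OF this, of i] \<psi>(2) obtain b where b: "b \<in> B \<chi>"
    unfolding B_def by auto
  have "b \<in> B (\<chi> \<circ> \<omega>)" if "emb \<omega>" for \<omega>
  proof -
    have "range (\<psi> \<circ> (\<chi> \<circ> \<omega>)) \<subseteq> range (\<psi> \<circ> \<chi>)" by auto
    then have "tree_node x m \<in> range (\<psi> \<circ> \<chi>)" if "tree_node x m \<in> range (\<psi> \<circ> (\<chi> \<circ> \<omega>))" for x m
      using that by (rule subsetD)
    then have "B (\<chi> \<circ> \<omega>) \<subseteq> B \<chi>"
      unfolding B_def by (intro Collect_mono impI conj_mono ex_mono all_mono imp_mono) auto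
    moreover have "card (B \<chi>) \<le> card (B (\<chi> \<circ> \<omega>))" using \<chi>(2) emb_comp[OF \<chi>(1) that] by blast
    ultimately have "B (\<chi> \<circ> \<omega>) = B \<chi>" using fin card_seteq by blast
    then show ?thesis using b by simp
  qed
  then show ?thesis using \<chi>(1) b by (intro exI[of _ \<chi>] exI[of _ b]) (auto simp: B_def comp_assoc)
qed

text \<open>The answer comes from \<open>persistent_answer\<close>. Bad labellings for all
  \<open>n\<close> would have a cluster point; on a subtree where it is constant the answer still
  occurs, and its finite tree is hit by one of the bad labellings.\<close>

lemma large_cone:
  assumes i: "i \<in> dense_colours r \<tau>" and M: "M > 0"
  shows "\<exists>b<j. \<exists>n. large r V k n {t. \<tau> \<sqsubseteq> t \<and> t < n} (\<lambda>i'. if i' = i then Suc b else 0) M"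
proof -
  obtain \<psi> where \<psi>: "emb \<psi>" "\<And>n. r (\<psi> n) = i" "\<And>n. \<tau> \<sqsubseteq> \<psi> n"
    using dense_colours_embedding[OF i] by blast
  obtain \<chi> b where \<chi>: "emb \<chi>" "b < j" "\<And>\<omega>. emb \<omega> \<Longrightarrow>
      \<exists>x. finite_solution r V x i b \<and> (\<forall>m<Suc (2 * tree_height x). tree_node x m \<in> range (\<psi> \<circ> \<chi> \<circ> \<omega>))"
    using persistent_answer[OF \<psi>(1,2)] by blast
  let ?a = "\<lambda>i'. if i' = i then Suc b else 0"
  have "\<exists>n. large r V k n {t. \<tau> \<sqsubseteq> t \<and> t < n} ?a M"
  proof (rule ccontr)
    assume "\<nexists>n. large r V k n {t. \<tau> \<sqsubseteq> t \<and> t < n} ?a M"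
    then have "\<forall>n. \<exists>u. admissible k {t. \<tau> \<sqsubseteq> t \<and> t < n} ?a M u \<and> \<not> hits r V n {t. \<tau> \<sqsubseteq> t \<and> t < n} ?a u"
      unfolding large_def by blast
    from choice[OF this] obtain U where adm: "\<And>n. admissible k {t. \<tau> \<sqsubseteq> t \<and> t < n} ?a M (U n)"
      and no_hit: "\<And>n. \<not> hits r V n {t. \<tau> \<sqsubseteq> t \<and> t < n} ?a (U n)"
      by auto
    have U: "fst (U n t) < M \<and> ?a (snd (U n t)) \<noteq> 0" if "\<tau> \<sqsubseteq> t" "t < n" for n t
      using adm[of n] that unfolding admissible_def by blast
    \<comment> \<open>The default \<open>0\<close> makes \<open>v\<close> total; it is a legal label
      because \<open>M > 0\<close>.\<close>
    define v where "v n t = (if \<tau> \<sqsubseteq> t \<and> t < n then fst (U n t) else 0)" for n t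
    have "v n t < M" for n t using U[of t n] M by (simp add: v_def)
    from colouring_compactness[of v M, OF this] obtain v' where v': "\<And>t. v' t < M"
      "\<And>n. \<exists>n'\<ge>n. \<forall>t<n. v n' t = v' t" by blast
    obtain \<omega> z where \<omega>: "emb \<omega>" "\<And>n. v' ((\<psi> \<circ> \<chi>) (\<omega> n)) = z"
      using homogeneous_embedding[of v' M "\<psi> \<circ> \<chi>"] v'(1) by blast
    obtain x where x: "finite_solution r V x i b"
      "\<And>m. m < Suc (2 * tree_height x) \<Longrightarrow> tree_node x m \<in> range (\<psi> \<circ> \<chi> \<circ> \<omega>)"
      using \<chi>(3)[OF \<omega>(1)] by blast
    \<comment> \<open>Agreement up to \<open>n\<close> has to cover all nodes of the tree, and
      \<open>hits\<close> also bounds the code \<open>x\<close>.\<close>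
    define n where "n = Suc (x + sum (tree_node x) {..<Suc (2 * tree_height x)})"
    have node: "tree_node x m < n" if "m < Suc (2 * tree_height x)" for m
      using member_le_sum[of m "{..<Suc (2 * tree_height x)}" "tree_node x"] that by (simp add: n_def)
    obtain n' where n': "n \<le> n'" "\<And>t. t < n \<Longrightarrow> v n' t = v' t" using v'(2) by blast
    have "\<exists>t\<in>{t. \<tau> \<sqsubseteq> t \<and> t < n'}. tree_node x m \<sqsubseteq> t \<and> U n' t = (z, i)"
      if m: "m < Suc (2 * tree_height x)" for m
    proof -
      let ?t = "tree_node x m"
      have t: "\<tau> \<sqsubseteq> ?t" "?t < n'" "v' ?t = z"
        using x(2)[OF m] \<psi>(3) \<omega>(2) node[OF m] n'(1) by auto
      then have "fst (U n' ?t) = z" using n'(2)[OF node[OF m]] by (simp add: v_def)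
      moreover have "snd (U n' ?t) = i" using U[OF t(1,2)] by (auto split: if_splits)
      ultimately show ?thesis using t by (intro bexI[of _ ?t]) (auto simp: prod_eq_iff)
    qed
    moreover have "x < n'" using n'(1) by (simp add: n_def)
    ultimately have "hits r V n' {t. \<tau> \<sqsubseteq> t \<and> t < n'} ?a (U n')"
      using x(1) by (intro hitsI[of x _ _ i]) auto
    then show False using no_hit by blast
  qed
  then show ?thesis using \<chi>(2) by blast
qed

end

section \<open>Committing to one answer per colour\<close>

text \<open>Largeness of the initial segment below \<open>n\<close> in decidable form: a label
  \<open>(z, i)\<close> becomes \<open>z * k + i\<close>, and a labelling becomes a numeral in base
  \<open>M * k\<close>.\<close>

definition large_code :: "(nat \<Rightarrow> nat) \<Rightarrow> (baire \<Rightarrow> nat \<Rightarrow> nat) \<Rightarrow> nat \<Rightarrow> nat \<Rightarrow> (nat \<Rightarrow> nat) \<Rightarrow> nat \<Rightarrow> bool" where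
  "large_code r V k n a M \<longleftrightarrow>
     (\<forall>w<(M * k) ^ n. (\<forall>t<n. a (digit w (M * k) t mod k) \<noteq> 0) \<longrightarrow>
       (\<exists>z<M * k. \<exists>x<n. a (z mod k) \<noteq> 0 \<and> finite_solution r V x (z mod k) (a (z mod k) - 1) \<and>
         (\<forall>m<Suc (2 * tree_height x). \<exists>t<n. tree_node x m \<sqsubseteq> t \<and> digit w (M * k) t = z)))"

lemma large_code_iff:
  assumes "M > 0" "k > 0"
  shows "large_code r V k n a M \<longleftrightarrow> large r V k n {..<n} a M"
proof
  assume L: "large_code r V k n a M"
  show "large r V k n {..<n} a M"
    unfolding large_def
  proof (intro allI impI)
    fix u assume "admissible k {..<n} a M u"
    then have u: "\<And>t. t < n \<Longrightarrow> fst (u t) < M \<and> snd (u t) < k \<and> a (snd (u t)) \<noteq> 0"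
      by (simp add: admissible_def)
    define f where "f t = fst (u t) * k + snd (u t)" for t
    have "f t < M * k" if "t < n" for t
    proof -
      have "f t < Suc (fst (u t)) * k" using u[OF that] by (simp add: f_def)
      also have "\<dots> \<le> M * k" using u[OF that] by (intro mult_right_mono) auto
      finally show ?thesis .
    qed
    from digits_exist[of n f, OF this] obtain w where w: "w < (M * k) ^ n" "\<And>t. t < n \<Longrightarrow> digit w (M * k) t = f t"
      by blast
    have f: "f t mod k = snd (u t)" "f t div k = fst (u t)" if "t < n" for t
      using u[OF that] by (simp_all add: f_def)
    have "\<forall>t<n. a (digit w (M * k) t mod k) \<noteq> 0" using w(2) f u by simp
    then obtain z x where x: "x < n" "a (z mod k) \<noteq> 0" "finite_solution r V x (z mod k) (a (z mod k) - 1)"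
      "\<And>m. m < Suc (2 * tree_height x) \<Longrightarrow> \<exists>t<n. tree_node x m \<sqsubseteq> t \<and> digit w (M * k) t = z"
      using L w(1) unfolding large_code_def by blast
    have "u t = (z div k, z mod k)" if "t < n" "digit w (M * k) t = z" for t
      using that w(2) f by (metis prod.collapse)
    then have "\<exists>t\<in>{..<n}. tree_node x m \<sqsubseteq> t \<and> u t = (z div k, z mod k)" if "m < Suc (2 * tree_height x)" for m
      using x(4)[OF that] by blast
    then show "hits r V n {..<n} a u" using x(1-3) hitsI[of x n a "z mod k"] by blast
  qed
next
  assume L: "large r V k n {..<n} a M"
  show "large_code r V k n a M"
    unfolding large_code_def
  proof (intro allI impI)
    fix w assume w: "\<forall>t<n. a (digit w (M * k) t mod k) \<noteq> 0"
    let ?d = "digit w (M * k)"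
    have less: "?d t < M * k" for t using assms by (simp add: digit_less)
    have adm: "fst (?d t div k, ?d t mod k) < M \<and> snd (?d t div k, ?d t mod k) < k \<and> a (snd (?d t div k, ?d t mod k)) \<noteq> 0"
      if "t \<in> {..<n}" for t
      using that w less[of t] assms by (simp add: less_mult_imp_div_less)
    obtain x i z where x: "x < n" "a i \<noteq> 0" "finite_solution r V x i (a i - 1)"
      "\<And>m. m < Suc (2 * tree_height x) \<Longrightarrow> \<exists>t\<in>{..<n}. tree_node x m \<sqsubseteq> t \<and> (?d t div k, ?d t mod k) = (z, i)"
      by (rule largeD[where u = "\<lambda>t. (?d t div k, ?d t mod k)", OF L adm]) auto
    have d: "?d t = z * k + i" if "(?d t div k, ?d t mod k) = (z, i)" for t
      using that by (metis div_mult_mod_eq prod.inject)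
    \<comment> \<open>As a tree has at least one node, its label occurs among the digits, which
      bounds the code of the pair.\<close>
    obtain t where "(?d t div k, ?d t mod k) = (z, i)" using x(4)[of 0] by auto
    then have "i = ?d t mod k" "?d t = z * k + i" using d[of t] by simp_all
    then have "i < k" "z * k + i < M * k" using less[of t] assms by (metis mod_less_divisor, metis)
    moreover have "\<forall>m<Suc (2 * tree_height x). \<exists>t<n. tree_node x m \<sqsubseteq> t \<and> ?d t = z * k + i"
      using x(4) d by blast
    ultimately show "\<exists>z<M * k. \<exists>x<n. a (z mod k) \<noteq> 0 \<and> finite_solution r V x (z mod k) (a (z mod k) - 1) \<and>
         (\<forall>m<Suc (2 * tree_height x). \<exists>t<n. tree_node x m \<sqsubseteq> t \<and> digit w (M * k) t = z)"
      using x(1-3) by (intro exI[of _ "z * k + i"] conjI exI[of _ x]) simp_all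
  qed
qed

text \<open>Assignments are numerals in base \<open>Suc j\<close>: digit \<open>0\<close> means
  unassigned, digit \<open>Suc b\<close> promises the answer \<open>b\<close>.\<close>

definition extends :: "nat \<Rightarrow> nat \<Rightarrow> nat \<Rightarrow> nat \<Rightarrow> bool" where
  "extends k j A A' \<longleftrightarrow> (\<exists>i<k. digit A (Suc j) i = 0 \<and> digit A' (Suc j) i \<noteq> 0 \<and>
     (\<forall>i'<k. i' \<noteq> i \<longrightarrow> digit A' (Suc j) i' = digit A (Suc j) i'))"

text \<open>
  A state consists of the digits of the current assignment and the number of unassigned colours. The
  exponent drops with each commitment because the maximality argument has to partition a large set
  according to the commitment (if any) available above each of its nodes, in \<open>k * j + 1\<close> ways.
\<close>

definition candidate :: "(nat \<Rightarrow> nat) \<Rightarrow> (baire \<Rightarrow> nat \<Rightarrow> nat) \<Rightarrow> nat \<Rightarrow> nat \<Rightarrow> nat \<Rightarrow> nat \<Rightarrow> nat" where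
  "candidate r V k j s c = first (\<lambda>A'. extends k j (code_fst c) A' \<and>
     large_code r V k s (digit A' (Suc j)) (Suc (k * j) ^ (code_snd c - 1))) (Suc j ^ k)"

definition state :: "(nat \<Rightarrow> nat) \<Rightarrow> (baire \<Rightarrow> nat \<Rightarrow> nat) \<Rightarrow> nat \<Rightarrow> nat \<Rightarrow> nat \<Rightarrow> nat" where
  "state r V k j s = rec_nat (prod_encode (0, k))
     (\<lambda>s c. if candidate r V k j s c < Suc j ^ k then prod_encode (candidate r V k j s c, code_snd c - 1) else c) s"

abbreviation answer :: "(nat \<Rightarrow> nat) \<Rightarrow> (baire \<Rightarrow> nat \<Rightarrow> nat) \<Rightarrow> nat \<Rightarrow> nat \<Rightarrow> nat \<Rightarrow> nat \<Rightarrow> nat" where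
  "answer r V k j s \<equiv> digit (code_fst (state r V k j s)) (Suc j)"

lemma state_Suc_cases:
  obtains (same) "state r V k j (Suc s) = state r V k j s"
      "\<not> (\<exists>A'<Suc j ^ k. extends k j (code_fst (state r V k j s)) A' \<and>
         large_code r V k s (digit A' (Suc j)) (Suc (k * j) ^ (code_snd (state r V k j s) - 1)))"
    | (commit) "code_snd (state r V k j (Suc s)) = code_snd (state r V k j s) - 1"
      "extends k j (code_fst (state r V k j s)) (code_fst (state r V k j (Suc s)))"
      "large_code r V k s (answer r V k j (Suc s)) (Suc (k * j) ^ (code_snd (state r V k j s) - 1))"
proof (cases "candidate r V k j s (state r V k j s) < Suc j ^ k")
  case True
  then have S: "state r V k j (Suc s) = prod_encode (candidate r V k j s (state r V k j s), code_snd (state r V k j s) - 1)"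
    by (simp add: state_def)
  show ?thesis
    using first_less[OF True[unfolded candidate_def]] commit unfolding S candidate_def[symmetric] by simp
next
  case False
  then have S: "state r V k j (Suc s) = state r V k j s" by (simp add: state_def)
  show ?thesis
  proof (rule same[OF S])
    show "\<not> (\<exists>A'<Suc j ^ k. extends k j (code_fst (state r V k j s)) A' \<and>
         large_code r V k s (digit A' (Suc j)) (Suc (k * j) ^ (code_snd (state r V k j s) - 1)))"
    proof (intro notI, elim exE conjE)
      fix A' assume A': "A' < Suc j ^ k"
        and "extends k j (code_fst (state r V k j s)) A'"
          "large_code r V k s (digit A' (Suc j)) (Suc (k * j) ^ (code_snd (state r V k j s) - 1))"
      then have "candidate r V k j s (state r V k j s) \<le> A'"
        unfolding candidate_def by (intro first_le_if conjI)
      then show False using A' False by simp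
    qed
  qed
qed

text \<open>Each step only fills a digit that was \<open>0\<close>. This makes the translation of a
  colour into an answer independent of the stage.\<close>

lemma answer_persistent:
  assumes "i < k" "answer r V k j s i \<noteq> 0" "s \<le> s'"
  shows "answer r V k j s' i = answer r V k j s i"
  using assms(3)
proof (induction s' rule: dec_induct)
  case (step s')
  show ?case
  proof (cases rule: state_Suc_cases[of r V k j s'])
    case same
    then show ?thesis using step by simp
  next
    case commit
    then show ?thesis using step assms(1,2) unfolding extends_def by metis
  qed
qed simp

context tree_answers
begin

abbreviation "St \<equiv> state r V k j"
abbreviation "Ans \<equiv> answer r V k j"

lemma k_pos: "k > 0"
  using colour_less[of 0] by simp

lemma state_invariant:
  "code_snd (St s) = card {i. i < k \<and> Ans s i = 0} \<and> (\<exists>n. large r V k n {..<n} (Ans s) (Suc (k * j) ^ code_snd (St s)))"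
proof (induction s)
  case 0
  \<comment> \<open>With nothing assigned no label is admissible, and \<open>{..<1}\<close> is
    nonempty, so largeness is vacuous.\<close>
  have "large r V k 1 {..<1} (Ans 0) M" for M
    by (simp add: large_def admissible_def state_def digit_def)
  then have "\<exists>n. large r V k n {..<n} (Ans 0) (Suc (k * j) ^ code_snd (St 0))" by blast
  moreover have "code_snd (St 0) = k" "{i. i < k \<and> Ans 0 i = 0} = {..<k}"
    by (auto simp: state_def digit_def)
  ultimately show ?case by simp
next
  case (Suc s)
  show ?case
  proof (cases rule: state_Suc_cases[of r V k j s])
    case same
    show ?thesis unfolding same(1) by (rule Suc)
  next
    case commit
    obtain i where i: "i < k" "Ans s i = 0" "Ans (Suc s) i \<noteq> 0"
      "\<And>i'. i' < k \<Longrightarrow> i' \<noteq> i \<Longrightarrow> Ans (Suc s) i' = Ans s i'"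
      using commit(2) unfolding extends_def by blast
    have "{i. i < k \<and> Ans (Suc s) i = 0} = {i. i < k \<and> Ans s i = 0} - {i}"
    proof (intro set_eqI)
      fix x
      show "x \<in> {i. i < k \<and> Ans (Suc s) i = 0} \<longleftrightarrow> x \<in> {i. i < k \<and> Ans s i = 0} - {i}"
        using i(1-3) i(4)[of x] by (cases "x = i") auto
    qed
    then have "card {i. i < k \<and> Ans (Suc s) i = 0} = code_snd (St (Suc s))"
      using Suc commit(1) i(1,2) by simp
    moreover have "large r V k s {..<s} (Ans (Suc s)) (Suc (k * j) ^ code_snd (St (Suc s)))"
      using commit(1,3) k_pos large_code_iff by simp
    ultimately show ?thesis by auto
  qed
qed

lemma state_stable:
  "\<exists>s0. \<forall>s\<ge>s0. St s = St s0 \<and> St (Suc s) = St s"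
proof -
  have card: "code_snd (St s) = card {i. i < k \<and> Ans s i = 0}" for s using state_invariant by blast
  have decrease: "code_snd (St (Suc s)) \<le> code_snd (St s) \<and> (St (Suc s) \<noteq> St s \<longrightarrow> code_snd (St (Suc s)) < code_snd (St s))" for s
  proof (cases rule: state_Suc_cases[of r V k j s])
    case commit
    then obtain i where "i < k" "Ans s i = 0" unfolding extends_def by blast
    then have "{i. i < k \<and> Ans s i = 0} \<noteq> {}" by blast
    \<comment> \<open>Positivity makes the truncated subtraction a genuine decrease.\<close>
    then have "code_snd (St s) > 0" unfolding card by (simp add: card_gt_0_iff)
    then show ?thesis using commit(1) by simp
  qed simp
  obtain s0 where s0: "\<And>s. code_snd (St s0) \<le> code_snd (St s)"
    using ex_has_least_nat[of "\<lambda>_. True" 0 "\<lambda>s. code_snd (St s)"] by auto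
  have "St s = St s0" if "s \<ge> s0" for s
    using that
  proof (induction s rule: dec_induct)
    case (step s)
    then show ?case using s0[of "Suc s"] decrease[of s] by (metis not_le)
  qed simp
  then have "\<forall>s\<ge>s0. St s = St s0 \<and> St (Suc s) = St s" using le_SucI by presburger
  then show ?thesis by blast
qed

lemma stable_answers:
  "\<exists>s0 n Y. (\<forall>s\<ge>s0. Ans s = Ans s0) \<and> large r V k n Y (Ans s0) 1 \<and>
     (\<forall>\<tau>\<in>Y. \<tau> < n \<and> (\<forall>i<k. i \<in> dense_colours r \<tau> \<longrightarrow> Ans s0 i \<noteq> 0))"
proof -
  obtain s0 where stable: "\<forall>s\<ge>s0. St s = St s0 \<and> St (Suc s) = St s"
    using state_stable ..
  have s0: "St s = St s0" "St (Suc s) = St s" if "s \<ge> s0" for s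
    using stable that by blast+
  define a where "a = Ans s0"
  define \<rho> where "\<rho> = code_snd (St s0)"
  let ?N = "Suc (k * j)"
  obtain n where n: "large r V k n {..<n} a (?N ^ \<rho>)"
    using state_invariant unfolding a_def \<rho>_def by blast
  have \<rho>: "\<rho> = card {i. i < k \<and> a i = 0}" using state_invariant unfolding a_def \<rho>_def by blast
  have "\<exists>Y. large r V k n Y a 1 \<and> (\<forall>\<tau>\<in>Y. \<tau> < n \<and> (\<forall>i<k. i \<in> dense_colours r \<tau> \<longrightarrow> a i \<noteq> 0))"
  proof (cases "\<rho> = 0")
    case True
    then have "{i. i < k \<and> a i = 0} = {}" using \<rho> by simp
    then show ?thesis using n True by (intro exI[of _ "{..<n}"]) auto
  next
    case False
    define M where "M = ?N ^ (\<rho> - 1)"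
    have M: "M > 0" "?N ^ \<rho> = M * ?N"
      using power_minus_mult[of \<rho> ?N] False by (simp_all only: M_def zero_less_power zero_less_Suc)
    \<comment> \<open>\<open>c\<close> codes the answer \<open>c mod j\<close> for the colour
      \<open>c div j\<close>; \<open>P\<close> says that this commitment is available above
      \<open>\<tau>\<close> for an unassigned colour.\<close>
    define P where "P \<tau> c \<longleftrightarrow> a (c div j) = 0 \<and>
        (\<exists>n'. large r V k n' {t. \<tau> \<sqsubseteq> t \<and> t < n'} (\<lambda>i'. if i' = c div j then Suc (c mod j) else 0) M)" for \<tau> c
    \<comment> \<open>The value \<open>0\<close>, for no available commitment, is the extra piece in
      \<open>k * j + 1\<close>.\<close>
    define v where "v \<tau> = (if \<exists>c<k * j. P \<tau> c then Suc (LEAST c. c < k * j \<and> P \<tau> c) else 0)" for \<tau>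
    have v: "v \<tau> = Suc c \<Longrightarrow> c < k * j \<and> P \<tau> c" for \<tau> c
      using LeastI_ex[of "\<lambda>c. c < k * j \<and> P \<tau> c"] by (auto simp: v_def split: if_splits)
    have "v \<tau> < ?N" for \<tau> using v[of \<tau>] by (cases "v \<tau>") auto
    then obtain y where y: "y < ?N" "large r V k n {t \<in> {..<n}. v t = y} a M"
      using large_partition[of r V k n "{..<n}" a M ?N v] n M(2) by auto
    \<comment> \<open>A piece sharing one commitment would let it be made for the whole tree, and
      the search would find it after the assignment has become final.\<close>
    have "y = 0"
    proof (rule ccontr)
      assume "y \<noteq> 0"
      then obtain c where c: "y = Suc c" by (cases y) auto
      have "c < k * j" using y(1) c by simp
      define i b where "i = c div j" and "b = c mod j"
      have j: "j > 0" using \<open>c < k * j\<close> by (cases j) auto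
      have ib: "i < k" "b < j"
        using \<open>c < k * j\<close> j by (simp_all add: i_def b_def less_mult_imp_div_less)
      let ?Y = "{t \<in> {..<n}. v t = y}"
      have "\<exists>n'. large r V k n' {t. \<tau> \<sqsubseteq> t \<and> t < n'} (\<lambda>i'. if i' = i then Suc b else 0) M"
        if "\<tau> \<in> ?Y" for \<tau>
        using v[of \<tau> c] that c unfolding P_def i_def b_def by auto
      moreover have "a i = 0"
      \<comment> \<open>No tree is empty, so the empty set is never large.\<close>
      proof (cases "?Y = {}")
        case True
        then have "hits r V n {} a (\<lambda>_. (0, 0))"
          using y(2) by (simp only: large_def admissible_def ball_empty simp_thms)
        then show ?thesis unfolding hits_def by blast
      next
        case False
        then show ?thesis using v[of _ c] c unfolding P_def i_def by auto
      qed
      ultimately obtain n' where n': "large r V k n' {..<n'} (a(i := Suc b)) M"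
        using large_extend[OF y(2), of i b] by blast
      have "\<And>i'. i' < k \<Longrightarrow> (a(i := Suc b)) i' < Suc j"
        using ib(2) by (simp add: a_def digit_less)
      from digits_exist[of k "a(i := Suc b)", OF this] obtain A' where
        A': "A' < Suc j ^ k" "\<And>i'. i' < k \<Longrightarrow> digit A' (Suc j) i' = (a(i := Suc b)) i'" by blast
      \<comment> \<open>Stage \<open>s\<close> tests only the initial segment below
        \<open>s\<close>, so \<open>s\<close> must reach \<open>n'\<close>.\<close>
      define s where "s = max s0 n'"
      have "extends k j (code_fst (St s0)) A'"
        unfolding extends_def using ib(1) \<open>a i = 0\<close> A'(2) unfolding a_def
        by (intro exI[of _ i]) simp
      moreover have "large r V k s {..<s} (digit A' (Suc j)) M"
        using large_cong[OF large_mono[OF n', of s "{..<s}" M]] A'(2) by (auto simp: s_def)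
      then have "large_code r V k s (digit A' (Suc j)) M"
        using large_code_iff M(1) k_pos by blast
      moreover have "s \<ge> s0" by (simp add: s_def)
      from s0[OF this] have "St s = St s0" "St (Suc s) = St s" .
      ultimately show False
        using A'(1)
      proof (cases rule: state_Suc_cases[of r V k j s])
        case same
        then show ?thesis
          using A'(1) \<open>extends k j _ A'\<close> \<open>large_code r V k s _ M\<close> \<open>St s = St s0\<close>
          unfolding M_def \<rho>_def by metis
      next
        case commit
        then show ?thesis using \<open>St (Suc s) = St s\<close> unfolding extends_def by auto
      qed
    qed
    \<comment> \<open>By \<open>large_cone\<close> an unassigned dense colour has an available
      commitment, which piece \<open>0\<close> excludes.\<close>
    have "a i \<noteq> 0" if \<tau>: "v \<tau> = 0" "i < k" "i \<in> dense_colours r \<tau>" for \<tau> i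
    proof
      assume "a i = 0"
      obtain b n' where b: "b < j" "large r V k n' {t. \<tau> \<sqsubseteq> t \<and> t < n'} (\<lambda>i'. if i' = i then Suc b else 0) M"
        using large_cone[OF \<tau>(3) M(1)] by blast
      have "i * j + b < Suc i * j" using b(1) by simp
      also have "\<dots> \<le> k * j" using \<tau>(2) by (intro mult_right_mono) auto
      finally have "i * j + b < k * j" .
      moreover have d: "(i * j + b) div j = i" "(i * j + b) mod j = b" using b(1) by simp_all
      have "P \<tau> (i * j + b)" unfolding P_def d using b(2) \<open>a i = 0\<close> by blast
      ultimately show False using \<tau>(1) by (auto simp: v_def split: if_splits)
    qed
    moreover have "large r V k n {t \<in> {..<n}. v t = y} a 1"
      using large_mono[OF y(2), of n _ 1] M(1) by simp
    ultimately show ?thesis using \<open>y = 0\<close>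
      by (intro exI[of _ "{t \<in> {..<n}. v t = y}"]) auto
  qed
  then obtain Y where "large r V k n Y a 1"
    "\<forall>\<tau>\<in>Y. \<tau> < n \<and> (\<forall>i<k. i \<in> dense_colours r \<tau> \<longrightarrow> a i \<noteq> 0)" by blast
  moreover have "\<forall>s\<ge>s0. Ans s = a" using s0(1) unfolding a_def by metis
  ultimately show ?thesis unfolding a_def by blast
qed

end

text \<open>
  Only the assignment and \<open>pick\<close> change with \<open>s\<close>, and \<open>n\<close> bounds all nodes involved; once \<open>pick\<close> is
  correct on the finitely many nodes below the least successful \<open>n\<close>, every proposal is correct.
\<close>

definition proposal :: "(nat \<Rightarrow> nat) \<Rightarrow> (baire \<Rightarrow> nat \<Rightarrow> nat) \<Rightarrow> nat \<Rightarrow> nat \<Rightarrow> nat \<Rightarrow> nat \<Rightarrow> nat \<Rightarrow> bool" where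
  "proposal r V k j s n i \<longleftrightarrow> answer r V k j s i \<noteq> 0 \<and>
     (\<exists>x<n. finite_solution r V x i (answer r V k j s i - 1) \<and>
       (\<forall>m<Suc (2 * tree_height x). \<exists>t<n. tree_node x m \<sqsubseteq> t \<and> pick r s t = i))"

definition proposal_bound :: "(nat \<Rightarrow> nat) \<Rightarrow> (baire \<Rightarrow> nat \<Rightarrow> nat) \<Rightarrow> nat \<Rightarrow> nat \<Rightarrow> nat \<Rightarrow> nat" where
  "proposal_bound r V k j s = first (\<lambda>n. \<exists>i<k. proposal r V k j s n i) s"

definition proposed :: "(nat \<Rightarrow> nat) \<Rightarrow> (baire \<Rightarrow> nat \<Rightarrow> nat) \<Rightarrow> nat \<Rightarrow> nat \<Rightarrow> nat \<Rightarrow> nat" where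
  "proposed r V k j s = first (\<lambda>i. proposal r V k j s (proposal_bound r V k j s) i) k"

lemma (in tree_answers) proposed_correct:
  "\<exists>s0. \<forall>s\<ge>s0. proposed r V k j s < k \<and> Ans s (proposed r V k j s) \<noteq> 0 \<and>
     Ans s (proposed r V k j s) - 1 \<in> G"
proof -
  obtain s0 n Y where stable: "\<forall>s\<ge>s0. Ans s = Ans s0" and L: "large r V k n Y (Ans s0) 1"
    and dom: "\<forall>\<tau>\<in>Y. \<tau> < n \<and> (\<forall>i<k. i \<in> dense_colours r \<tau> \<longrightarrow> Ans s0 i \<noteq> 0)"
    using stable_answers by (elim exE conjE)
  have s0: "Ans s = Ans s0" if "s \<ge> s0" for s using stable that by blast
  have Y: "\<tau> < n" "i < k \<Longrightarrow> i \<in> dense_colours r \<tau> \<Longrightarrow> Ans s0 i \<noteq> 0" if "\<tau> \<in> Y" for \<tau> i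
    using dom that by blast+
  have "\<forall>x. \<exists>s0. \<forall>s\<ge>s0. pick r s x \<in> dense_colours r x"
    using pick_dense[of r k, OF colour_less] by blast
  from choice[OF this] obtain S where S: "\<And>x s. s \<ge> S x \<Longrightarrow> pick r s x \<in> dense_colours r x"
    by blast
  \<comment> \<open>Late enough for the assignment to be final, for the search for a bound to reach
    \<open>n\<close>, and for \<open>pick\<close> to be correct on all nodes below
    \<open>n\<close>.\<close>
  have "proposed r V k j s < k \<and> Ans s (proposed r V k j s) \<noteq> 0 \<and> Ans s (proposed r V k j s) - 1 \<in> G"
    if s: "s \<ge> s0 + Suc n + sum S {..<n}" for s
  proof -
    have dense: "pick r s t \<in> dense_colours r t" if "t < n" for t
      using member_le_sum[of t "{..<n}" S] s that by (intro S) simp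
    have As: "Ans s = Ans s0" by (rule s0) (use s in simp)
    \<comment> \<open>The picked colours are dense and hence assigned on \<open>Y\<close>; as
      \<open>M = 1\<close>, the tag is constantly \<open>0\<close>.\<close>
    have adm: "fst (0, pick r s t) < (1::nat) \<and> snd (0::nat, pick r s t) < k \<and> Ans s0 (snd (0::nat, pick r s t)) \<noteq> 0"
      if "t \<in> Y" for t
      using Y(2)[OF that _ dense] Y(1)[OF that] colour_less by (simp add: pick_def)
    obtain x i z where x: "x < n" "Ans s0 i \<noteq> 0" "finite_solution r V x i (Ans s0 i - 1)"
      "\<forall>m<Suc (2 * tree_height x). \<exists>t\<in>Y. tree_node x m \<sqsubseteq> t \<and> (0::nat, pick r s t) = (z, i)"
      by (rule largeD[where u = "\<lambda>t. (0, pick r s t)", OF L adm]) blast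
    have "i < k" using x(3) colour_less unfolding finite_solution_def by blast
    moreover have "proposal r V k j s n i"
      unfolding proposal_def As using x Y(1) by blast
    ultimately have bound: "proposal_bound r V k j s \<le> n"
      unfolding proposal_bound_def by (intro first_le_if) blast
    then have "proposal_bound r V k j s < s" using s by simp
    then obtain i' where i': "i' < k" "proposal r V k j s (proposal_bound r V k j s) i'"
      using first_less[of "\<lambda>n. \<exists>i<k. proposal r V k j s n i" s] unfolding proposal_bound_def by auto
    then have "proposed r V k j s < k"
      using first_le_if[of "proposal r V k j s (proposal_bound r V k j s)" i' k]
      unfolding proposed_def by simp
    moreover from this have p: "proposal r V k j s (proposal_bound r V k j s) (proposed r V k j s)"
      unfolding proposed_def by (rule first_less)
    let ?i = "proposed r V k j s"
    obtain x where x: "Ans s ?i \<noteq> 0" "finite_solution r V x ?i (Ans s ?i - 1)"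
      "\<And>m. m < Suc (2 * tree_height x) \<Longrightarrow> \<exists>t<n. tree_node x m \<sqsubseteq> t \<and> pick r s t = ?i"
    proof -
      obtain x where sol: "Ans s ?i \<noteq> 0" "finite_solution r V x ?i (Ans s ?i - 1)"
        and x: "\<forall>m<Suc (2 * tree_height x). \<exists>t<proposal_bound r V k j s. tree_node x m \<sqsubseteq> t \<and> pick r s t = ?i"
        using p unfolding proposal_def by blast
      have "\<exists>t<n. tree_node x m \<sqsubseteq> t \<and> pick r s t = ?i" if m: "m < Suc (2 * tree_height x)" for m
      proof -
        obtain t where "t < proposal_bound r V k j s" "tree_node x m \<sqsubseteq> t" "pick r s t = ?i"
          using x m by blast
        then show ?thesis using bound by (intro exI[of _ t]) simp
      qed
      with sol show thesis by (rule that)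
    qed
    have "?i \<in> dense_colours r (tree_node x m)" if m: "m < Suc (2 * tree_height x)" for m
    proof -
      obtain t where t: "t < n" "tree_node x m \<sqsubseteq> t" "pick r s t = ?i" using x(3)[OF m] by blast
      show ?thesis using dense[OF t(1)] dense_colours_antimono[OF t(2)] unfolding t(3) by blast
    qed
    from finite_solution_correct[OF x(2) this] have "Ans s ?i - 1 \<in> G" .
    ultimately show ?thesis using x(1) by blast
  qed
  then show ?thesis by blast
qed

section \<open>Computability of the construction\<close>

lemma dec_tle [rec_intros]:
  assumes "total_rec A" "total_rec B" shows "dec (\<lambda>q n. A q n \<sqsubseteq> B q n)"
proof -
  have "dec (\<lambda>q z. code_fst z \<sqsubseteq> code_snd z)" unfolding tle_def by (intro rec_intros)
  from total_rec_comp2[of "\<lambda>q a b. of_bool (a \<sqsubseteq> b)", OF this assms] show ?thesis .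
qed

lemma total_rec_digit [rec_intros]:
  assumes "total_rec A" "total_rec B" "total_rec C" shows "total_rec (\<lambda>q n. digit (A q n) (B q n) (C q n))"
  unfolding digit_def by (intro rec_intros assms)

lemma total_rec_tree_height [rec_intros]: "total_rec A \<Longrightarrow> total_rec (\<lambda>q n. tree_height (A q n))"
  unfolding tree_height_def by (intro rec_intros)

lemma total_rec_tree_fuel [rec_intros]: "total_rec A \<Longrightarrow> total_rec (\<lambda>q n. tree_fuel (A q n))"
  unfolding tree_fuel_def by (intro rec_intros)

lemma total_rec_tree_node [rec_intros]:
  "total_rec A \<Longrightarrow> total_rec B \<Longrightarrow> total_rec (\<lambda>q n. tree_node (A q n) (B q n))"
  unfolding tree_node_def by (intro rec_intros)

section \<open>Weihrauch reductions\<close>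

text \<open>The oracle is \<open>bpair p r\<close> for an instance \<open>p\<close> and the name \<open>r\<close> of the colouring computed from it.\<close>

definition colouring_of :: "baire \<Rightarrow> nat \<Rightarrow> nat" where
  "colouring_of q n = q (2 * n + 1)"

text \<open>The backward functional reads \<open>bpair p X\<close>; its even entries are those of
  the oracle, at the same positions. It is evaluated at \<open>0\<close> because
  \<open>fin_space\<close> reads the answer from entry \<open>0\<close>.\<close>

definition value_of :: "prog \<Rightarrow> baire \<Rightarrow> baire \<Rightarrow> nat \<Rightarrow> nat" where
  "value_of e q X f = stage e (\<lambda>m. if even m then q m else X (m div 2)) f 0"

lemma total_rec_colouring_of [rec_intros]:
  "total_rec A \<Longrightarrow> total_rec (\<lambda>q n. colouring_of q (A q n))"
  unfolding colouring_of_def by (intro rec_intros total_rec_query)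

lemma dec_fork [rec_intros]:
  assumes "total_rec A" "total_rec B" shows "dec (\<lambda>q n. fork (tree_node (A q n)) (B q n))"
  unfolding fork_def by (intro rec_intros assms)

lemma dec_finite_solution [rec_intros]:
  assumes "total_rec A" "total_rec B" "total_rec C"
  shows "dec (\<lambda>q n. finite_solution (colouring_of q) (value_of e q) (A q n) (B q n) (C q n))"
proof -
  have "dec (\<lambda>q z. finite_solution (colouring_of q) (value_of e q) (code_fst z) (code_fst (code_snd z)) (code_snd (code_snd z)))"
    unfolding finite_solution_def value_of_def by (intro rec_intros total_rec_query)
  from total_rec_comp3[of "\<lambda>q a b c. of_bool (finite_solution (colouring_of q) (value_of e q) a b c)", OF this assms]
  show ?thesis .
qed

lemma total_rec_pick [rec_intros]:
  assumes "total_rec A" "total_rec B"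
  shows "total_rec (\<lambda>q n. pick (colouring_of q) (A q n) (B q n))"
proof -
  have "total_rec (\<lambda>q z. pick (colouring_of q) (code_fst z) (code_snd z))"
    unfolding pick_def nested_cone_def by (intro rec_intros)
  from total_rec_comp2[of "\<lambda>q a b. pick (colouring_of q) a b", OF this assms] show ?thesis .
qed

lemma total_rec_candidate [rec_intros]:
  assumes "total_rec A" "total_rec B"
  shows "total_rec (\<lambda>q n. candidate (colouring_of q) (value_of e q) k j (A q n) (B q n))"
proof -
  have "total_rec (\<lambda>q z. candidate (colouring_of q) (value_of e q) k j (code_fst z) (code_snd z))"
    unfolding candidate_def extends_def large_code_def by (intro rec_intros)
  from total_rec_comp2[of "\<lambda>q a b. candidate (colouring_of q) (value_of e q) k j a b", OF this assms]
  show ?thesis .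
qed

lemma total_rec_state [rec_intros]:
  assumes "total_rec A"
  shows "total_rec (\<lambda>q n. state (colouring_of q) (value_of e q) k j (A q n))"
  unfolding state_def by (intro rec_intros assms)

lemma dec_proposal [rec_intros]:
  assumes "total_rec A" "total_rec B" "total_rec C"
  shows "dec (\<lambda>q n. proposal (colouring_of q) (value_of e q) k j (A q n) (B q n) (C q n))"
proof -
  have "dec (\<lambda>q z. proposal (colouring_of q) (value_of e q) k j (code_fst z) (code_fst (code_snd z)) (code_snd (code_snd z)))"
    unfolding proposal_def by (intro rec_intros)
  from total_rec_comp3[of "\<lambda>q a b c. of_bool (proposal (colouring_of q) (value_of e q) k j a b c)", OF this assms]
  show ?thesis .
qed

lemma total_rec_proposed [rec_intros]:
  assumes "total_rec A"
  shows "total_rec (\<lambda>q n. proposed (colouring_of q) (value_of e q) k j (A q n))"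
proof -
  have "total_rec (\<lambda>q n. proposed (colouring_of q) (value_of e q) k j n)"
    unfolding proposed_def proposal_bound_def by (intro rec_intros)
  from total_rec_comp[OF this assms] show ?thesis .
qed

lemma bpair_even [simp]: "bpair p q (2 * n) = p n"
  and bpair_odd [simp]: "bpair p q (Suc (2 * n)) = q n"
  by (simp_all add: bpair_def)

lemma colouring_of_bpair [simp]: "colouring_of (bpair p r) = r"
  by (simp add: colouring_of_def fun_eq_iff)

lemma value_of_bpair: "value_of e (bpair p r) X f = stage e (bpair p X) f 0"
proof -
  have "(\<lambda>m. if even m then bpair p r m else X (m div 2)) = bpair p X"
    by (simp add: fun_eq_iff bpair_def)
  then show ?thesis by (simp add: value_of_def)
qed

text \<open>Used with \<open>e\<close> reproducing the instance and \<open>e'\<close> computing the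
  colouring from it.\<close>

lemma eval_bpair_ex:
  "\<exists>g. \<forall>w p r. (\<forall>n. eval w e n (p n)) \<longrightarrow> (\<forall>n. eval w e' n (r n)) \<longrightarrow> (\<forall>n. eval w g n (bpair p r n))"
proof -
  have "total_rec (\<lambda>q z. if even (code_fst z) then code_fst (code_snd z) else code_snd (code_snd z))"
    "total_rec (\<lambda>q n. n div 2)" by (intro rec_intros)+
  then obtain c d
    where c: "\<And>w z. eval w c z (if even (code_fst z) then code_fst (code_snd z) else code_snd (code_snd z))"
      and d: "\<And>w n. eval w d n (n div 2)"
    unfolding total_rec_def by blast
  have "eval w (Comp c (Join (Join Left Right) (Comp (Join e e') d))) n (bpair p r n)"
    if "\<And>n. eval w e n (p n)" "\<And>n. eval w e' n (r n)" for w p r n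
  proof -
    have id: "eval w (Join Left Right) n n"
      using eval_join[OF eval_code_fst[of w n] eval_code_snd[of w n]] by simp
    let ?z = "prod_encode (n, prod_encode (p (n div 2), r (n div 2)))"
    have "bpair p r n = (if even (code_fst ?z) then code_fst (code_snd ?z) else code_snd (code_snd ?z))"
      by (simp add: bpair_def)
    then show ?thesis
      using eval_comp[OF eval_join[OF id eval_comp[OF d eval_join[OF that]]] c] by simp
  qed
  then show ?thesis by blast
qed

lemma RT1_simps [simp]: "src (RT1 k) = seq_colouring_space k" "tgt (RT1 k) = fin_space k"
  and TT1_simps [simp]: "src (TT1 k) = tree_colouring_space k" "tgt (TT1 k) = string_set_space"
  by (simp_all add: RT1_def TT1_def)

lemma iso_full_tree_range:
  assumes "emb \<psi>"
  shows "iso_full_tree {\<sigma>. node_code \<sigma> \<in> range \<psi>}"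
  unfolding iso_full_tree_def
proof (intro exI conjI allI)
  let ?\<phi> = "\<lambda>\<sigma>. inv node_code (\<psi> (node_code \<sigma>))"
  have nc: "node_code (inv node_code n) = n" for n
    using bij_node_code by (simp add: bij_is_surj surj_f_inv_f)
  show "prefix \<sigma> \<tau> \<longleftrightarrow> prefix (?\<phi> \<sigma>) (?\<phi> \<tau>)" for \<sigma> \<tau>
    using assms by (simp add: nc emb_def flip: tle_node_code)
  show "bij_betw ?\<phi> UNIV {\<sigma>. node_code \<sigma> \<in> range \<psi>}"
    unfolding bij_betw_def
  proof
    show "inj ?\<phi>"
    proof (rule injI)
      fix \<sigma> \<tau> assume "?\<phi> \<sigma> = ?\<phi> \<tau>"
      then have "\<psi> (node_code \<sigma>) = \<psi> (node_code \<tau>)" by (metis nc)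
      then show "\<sigma> = \<tau>" using emb_inj[OF assms] bij_node_code by (simp add: inj_eq bij_is_inj)
    qed
    show "range ?\<phi> = {\<sigma>. node_code \<sigma> \<in> range \<psi>}"
    proof (intro set_eqI iffI)
      fix \<sigma> assume "\<sigma> \<in> {\<sigma>. node_code \<sigma> \<in> range \<psi>}"
      then obtain n where n: "node_code \<sigma> = \<psi> n" by blast
      obtain \<tau> where "n = node_code \<tau>" by (rule node_code_cases)
      then have "\<sigma> = ?\<phi> \<tau>" using n bij_node_code by (metis bij_is_inj inv_f_f)
      then show "\<sigma> \<in> range ?\<phi>" by blast
    qed (auto simp: nc)
  qed
qed

lemma iso_full_tree_infinite: "iso_full_tree S \<Longrightarrow> infinite S"
  unfolding iso_full_tree_def using infinite_UNIV_listI by (metis bij_betw_finite)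

definition char_fun :: "nat set \<Rightarrow> baire" where
  "char_fun S n = of_bool (n \<in> S)"

lemma TT1_solution:
  assumes "tree_colouring_space k r = Some c" "emb \<psi>" "\<And>n. r (\<psi> n) = i"
  shows "string_set_space (char_fun (range \<psi>)) = Some {\<sigma>. node_code \<sigma> \<in> range \<psi>}"
    and "{\<sigma>. node_code \<sigma> \<in> range \<psi>} \<in> sol (TT1 k) c"
proof -
  show "string_set_space (char_fun (range \<psi>)) = Some {\<sigma>. node_code \<sigma> \<in> range \<psi>}"
    by (simp add: string_set_space_def char_fun_def)
  have c: "c = (\<lambda>\<sigma>. r (node_code \<sigma>))" "\<And>n. r n < k"
    using assms(1) by (auto simp: tree_colouring_space_def split: if_splits)
  then show "{\<sigma>. node_code \<sigma> \<in> range \<psi>} \<in> sol (TT1 k) c"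
    using iso_full_tree_range[OF assms(2)] assms(3) by (auto simp: TT1_def)
qed

lemma TT1_solvable:
  assumes "tree_colouring_space k r = Some c"
  shows "sol (TT1 k) c \<noteq> {}"
proof -
  have "r n < k" for n using assms by (auto simp: tree_colouring_space_def split: if_splits)
  then obtain i where "i \<in> dense_colours r 0" using dense_colours_nonempty[of r k] by blast
  then obtain \<psi> where "emb \<psi>" "\<And>n. r (\<psi> n) = i" using dense_colours_embedding by blast
  then show ?thesis using TT1_solution(2)[OF assms] by blast
qed

text \<open>A reduction speaks about realizers only, so one must exist before it can be altered to
  return a prescribed solution.\<close>

definition canonical_realizer :: "('a, 'b) problem \<Rightarrow> baire \<rightharpoonup> baire" where
  "canonical_realizer f p = (case src f p of None \<Rightarrow> None
     | Some x \<Rightarrow> if sol f x = {} then None else Some (SOME q. \<exists>y\<in>sol f x. tgt f q = Some y))"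

lemma realizes_canonical_realizer:
  assumes "is_problem f"
  shows "realizes (canonical_realizer f) f"
  unfolding realizes_def
proof (intro allI impI)
  fix p x assume px: "src f p = Some x \<and> sol f x \<noteq> {}"
  then obtain y where y: "y \<in> sol f x" by blast
  then have "y \<in> ran (tgt f)" using assms by (auto simp: is_problem_def)
  then have "\<exists>q. \<exists>y\<in>sol f x. tgt f q = Some y" using y by (auto simp: ran_def)
  from someI_ex[OF this] show "\<exists>q y. canonical_realizer f p = Some q \<and> tgt f q = Some y \<and> y \<in> sol f x"
    using px by (auto simp: canonical_realizer_def)
qed

lemma realizes_fun_upd:
  assumes "realizes F f" "src f p = Some x" "tgt f q = Some y" "y \<in> sol f x"
  shows "realizes (F(p := Some q)) f"
  using assms unfolding realizes_def by auto

lemma realizesE: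
  assumes "realizes G f" "src f p = Some x" "sol f x \<noteq> {}"
  obtains q y where "G p = Some q" "tgt f q = Some y" "y \<in> sol f x"
  using assms unfolding realizes_def by blast

lemma realizes_compD:
  assumes "realizes (\<lambda>p. Option.bind (K p) (\<lambda>r. Option.bind (G r) (\<lambda>q. H (bpair p q)))) f"
    and "src f p = Some x" "sol f x \<noteq> {}"
  obtains r q u y where "K p = Some r" "G r = Some q" "H (bpair p q) = Some u" "tgt f u = Some y" "y \<in> sol f x"
proof -
  obtain u y where "Option.bind (K p) (\<lambda>r. Option.bind (G r) (\<lambda>q. H (bpair p q))) = Some u"
    and y: "tgt f u = Some y" "y \<in> sol f x"
    by (rule realizesE[OF assms])
  then obtain r q where "K p = Some r" "G r = Some q" "H (bpair p q) = Some u"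
    by (auto simp: bind_eq_Some_conv)
  then show thesis using y by (rule that)
qed

text \<open>Altering a realizer at the name \<open>r\<close> to return the range of an arbitrary
  \<open>\<psi>\<close> shows that the backward functional gives a correct answer on every
  monochromatic copy.\<close>

lemma reduction_instance:
  fixes h :: "('x, nat) problem"
  assumes h: "is_problem h" "tgt h = fin_space j"
    and H: "\<And>p q n. H p = Some q \<Longrightarrow> eval p eH n (q n)"
    and red: "\<And>G. realizes G (TT1 k) \<Longrightarrow>
      realizes (\<lambda>p. Option.bind (K p) (\<lambda>r. Option.bind (G r) (\<lambda>q. H (bpair p q)))) h"
    and p: "src h p = Some x" "sol h x \<noteq> {}"
  shows "\<exists>r. K p = Some r \<and> tree_answers r (value_of eH (bpair p r)) k j (sol h x)"
proof -
  let ?G = "canonical_realizer (TT1 k)"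
  have G: "realizes ?G (TT1 k)" by (rule realizes_canonical_realizer[OF is_problem_TT1])
  obtain r q where r: "K p = Some r" "?G r = Some q"
    by (rule realizes_compD[OF red[OF G] p])
  then obtain c where c: "tree_colouring_space k r = Some c"
    unfolding canonical_realizer_def by (auto simp: TT1_def split: option.splits)
  have "tree_answers r (value_of eH (bpair p r)) k j (sol h x)"
  proof
    show "r n < k" for n using c by (auto simp: tree_colouring_space_def split: if_splits)
    show "value_of eH (bpair p r) X f = value_of eH (bpair p r) X' f"
      if "\<And>n. n < f \<Longrightarrow> X n = X' n" for f X X'
      unfolding value_of_bpair using that by (intro stage_local) (simp add: bpair_def)
    show "value_of eH (bpair p r) X f' = Suc b" if "f \<le> f'" "value_of eH (bpair p r) X f = Suc b" for f f' X b
      using that stage_mono unfolding value_of_bpair by blast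
    show "b < j" if "b \<in> sol h x" for b
    proof -
      have "b \<in> ran (fin_space j)" using h that by (auto simp: is_problem_def)
      then show ?thesis by (simp add: ran_fin_space)
    qed
    show "\<exists>f b. value_of eH (bpair p r) (\<lambda>n. of_bool (n \<in> range \<psi>)) f = Suc b \<and> b \<in> sol h x"
      if \<psi>: "emb \<psi>" "\<And>n. r (\<psi> n) = i" for \<psi> i
    proof -
      let ?q = "char_fun (range \<psi>)"
      have real: "realizes (?G(r := Some ?q)) (TT1 k)"
        using TT1_solution[OF c \<psi>] c by (intro realizes_fun_upd[OF G]) (auto simp: TT1_def)
      obtain u y where u: "H (bpair p ?q) = Some u" "fin_space j u = Some y" "y \<in> sol h x"
        by (rule realizes_compD[OF red[OF real] p]) (use r(1) h(2) in auto)
      have "y = u 0" using u(2) by (auto simp: fin_space_def split: if_splits)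
      moreover obtain f where "stage eH (bpair p ?q) f 0 = Suc (u 0)"
        using stage_complete[OF H[OF u(1)]] by blast
      moreover have "?q = (\<lambda>n. of_bool (n \<in> range \<psi>))" by (simp add: char_fun_def fun_eq_iff)
      ultimately show ?thesis using u(3) unfolding value_of_bpair by auto
    qed
  qed
  then show ?thesis using r(1) by blast
qed

text \<open>A finitary part must have codomain \<open>j\<close>, whereas
  \<open>RT1 (min j k)\<close> has codomain \<open>min j k\<close>; only the codomain is
  changed.\<close>

definition fin_RT1 :: "nat \<Rightarrow> nat \<Rightarrow> (baire, nat) problem" where
  "fin_RT1 j k = RT1 (min j k)\<lparr>tgt := fin_space j\<rparr>"

lemma fin_RT1_simps [simp]:
  "src (fin_RT1 j k) = seq_colouring_space (min j k)"
  "tgt (fin_RT1 j k) = fin_space j"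
  "sol (fin_RT1 j k) = sol (RT1 (min j k))"
  by (simp_all add: fin_RT1_def RT1_def)

lemma is_problem_fin_RT1: "is_problem (fin_RT1 j k)"
  using is_problem_RT1[of "min j k"]
  by (auto simp: is_problem_def ran_fin_space) (auto simp: RT1_def ran_fin_space)

lemma computable_Some: "computable Some"
  unfolding computable_def by (rule exI[of _ Query]) (auto intro: eval_query)

lemma computable_odd: "computable (\<lambda>w. Some (\<lambda>n. w (2 * n + 1)))"
proof -
  have "total_rec (\<lambda>w n. w (2 * n + 1))" by (intro rec_intros total_rec_query)
  then show ?thesis unfolding computable_def total_rec_def by auto
qed

lemma weihrauch_leI:
  assumes "computable H" "computable K"
    and "\<And>G p x. realizes G g \<Longrightarrow> src f p = Some x \<Longrightarrow> sol f x \<noteq> {} \<Longrightarrow>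
      \<exists>r q u y. K p = Some r \<and> G r = Some q \<and> H (bpair p q) = Some u \<and> tgt f u = Some y \<and> y \<in> sol f x"
  shows "f \<le>\<^sub>W g"
  unfolding weihrauch_le_def
proof (intro exI conjI allI impI)
  fix G assume "realizes G g"
  then show "realizes (\<lambda>p. Option.bind (K p) (\<lambda>r. Option.bind (G r) (\<lambda>q. H (bpair p q)))) f"
    unfolding realizes_def[of _ f] using assms(3) by fastforce
qed (use assms in auto)

lemma fin_RT1_equiv: "fin_RT1 j k \<equiv>\<^sub>W RT1 (min j k)"
  unfolding weihrauch_equiv_def
proof
  let ?H = "\<lambda>w. Some (\<lambda>n. w (2 * n + 1)) :: baire option"
  have odd: "?H (bpair p q) = Some q" for p q by simp
  show "fin_RT1 j k \<le>\<^sub>W RT1 (min j k)"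
  proof (rule weihrauch_leI[OF computable_odd computable_Some])
    fix G p x assume G: "realizes G (RT1 (min j k))"
      and p: "src (fin_RT1 j k) p = Some x" "sol (fin_RT1 j k) x \<noteq> {}"
    obtain q y where "G p = Some q" "fin_space (min j k) q = Some y" "y \<in> sol (RT1 (min j k)) x"
      by (rule realizesE[OF G, of p x]) (use p in auto)
    then show "\<exists>r q u y. Some p = Some r \<and> G r = Some q \<and> ?H (bpair p q) = Some u \<and>
        tgt (fin_RT1 j k) u = Some y \<and> y \<in> sol (fin_RT1 j k) x"
      unfolding odd by (auto simp: fin_space_def split: if_splits)
  qed
  show "RT1 (min j k) \<le>\<^sub>W fin_RT1 j k"
  proof (rule weihrauch_leI[OF computable_odd computable_Some])
    fix G p x assume G: "realizes G (fin_RT1 j k)"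
      and p: "src (RT1 (min j k)) p = Some x" "sol (RT1 (min j k)) x \<noteq> {}"
    obtain q y where q: "G p = Some q" "fin_space j q = Some y" "y \<in> sol (RT1 (min j k)) x"
      by (rule realizesE[OF G, of p x]) (use p in auto)
    then have "tgt (RT1 (min j k)) q = Some y"
      by (auto simp: RT1_def fin_space_def split: if_splits)
    then show "\<exists>r q u y. Some p = Some r \<and> G r = Some q \<and> ?H (bpair p q) = Some u \<and>
        tgt (RT1 (min j k)) u = Some y \<and> y \<in> sol (RT1 (min j k)) x"
      unfolding odd using q by auto
  qed
qed

lemma fin_RT1_le_TT1: "fin_RT1 j k \<le>\<^sub>W TT1 k"
proof -
  define H :: "baire \<rightharpoonup> baire" where
    "H w = (if \<exists>n. w (2 * n + 1) = 1 then Some (\<lambda>_. w (2 * (LEAST n. w (2 * n + 1) = 1))) else None)" for w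
  have "dec (\<lambda>w z. w (2 * code_snd z + 1) = 1)" by (intro rec_intros total_rec_query)
  from eval_search[of "\<lambda>w _ n. w (2 * n + 1) = 1", OF this] obtain e
    where e: "\<And>w m. \<exists>n. w (2 * n + 1) = 1 \<Longrightarrow> eval w e m (LEAST n. w (2 * n + 1) = 1)" by blast
  have "total_rec (\<lambda>w n. w (2 * n))" by (intro rec_intros total_rec_query)
  then obtain e' where e': "\<And>w n. eval w e' n (w (2 * n))" unfolding total_rec_def by blast
  have "computable H"
    unfolding computable_def
  proof (intro exI[of _ "Comp e' e"] allI impI)
    fix w u n assume "H w = Some u"
    then have "\<exists>n. w (2 * n + 1) = 1" "u n = w (2 * (LEAST n. w (2 * n + 1) = 1))"
      by (auto simp: H_def split: if_splits)
    then show "eval w (Comp e' e) n (u n)" using eval_comp[OF e e'] by simp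
  qed
  then show ?thesis
  proof (rule weihrauch_leI[OF _ computable_Some])
    fix G p x assume G: "realizes G (TT1 k)"
      and p: "src (fin_RT1 j k) p = Some x" "sol (fin_RT1 j k) x \<noteq> {}"
    have x: "x = p" "\<And>n. p n < min j k"
      using p(1) by (auto simp: seq_colouring_space_def split: if_splits)
    let ?c = "\<lambda>\<sigma>. p (node_code \<sigma>)"
    have c: "tree_colouring_space k p = Some ?c"
      using x(2) by (simp add: tree_colouring_space_def)
    obtain q S where q: "G p = Some q" "string_set_space q = Some S" "S \<in> sol (TT1 k) ?c"
      by (rule realizesE[OF G _ TT1_solvable[OF c]]) (use c in auto)
    obtain i where S: "iso_full_tree S" "\<And>\<sigma>. \<sigma> \<in> S \<Longrightarrow> ?c \<sigma> = i" using q(3) by (auto simp: TT1_def)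
    have S_eq: "S = {\<sigma>. q (node_code \<sigma>) = 1}"
      using q(2) by (auto simp: string_set_space_def split: if_splits)
    \<comment> \<open>Infinity of \<open>S\<close> serves twice: the colour class is infinite, and
      the search for a node of \<open>S\<close> terminates.\<close>
    have inf: "infinite S" by (rule iso_full_tree_infinite[OF S(1)])
    then have "infinite (node_code ` S)"
      using bij_node_code by (metis bij_is_inj finite_imageD inj_on_subset subset_UNIV)
    moreover have "node_code ` S \<subseteq> p -` {i}" using S(2) by auto
    ultimately have "infinite (p -` {i})" using finite_subset by blast
    obtain \<sigma> where "\<sigma> \<in> S" using inf by fastforce
    then have ex: "\<exists>n. q n = 1" using S_eq by blast
    obtain \<tau> where "(LEAST n. q n = 1) = node_code \<tau>" by (rule node_code_cases)
    then have "p (LEAST n. q n = 1) = i"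
      using S(2)[of \<tau>] LeastI_ex[OF ex] S_eq by simp
    moreover have "H (bpair p q) = Some (\<lambda>_. p (LEAST n. q n = 1))"
      using ex by (simp add: H_def)
    moreover have "i < min j k" using S(2)[OF \<open>\<sigma> \<in> S\<close>] x(2) by metis
    ultimately show "\<exists>r q u y. Some p = Some r \<and> G r = Some q \<and> H (bpair p q) = Some u \<and>
        tgt (fin_RT1 j k) u = Some y \<and> y \<in> sol (fin_RT1 j k) x"
      using q(1) x \<open>infinite (p -` {i})\<close> by (simp add: fin_space_def RT1_def)
  qed
qed

text \<open>
  If \<open>j \<le> k\<close> then the sequence enumerates answers; otherwise it enumerates colours, which are translated
  to answers afterwards by waiting for the commitment.
\<close>

definition forward :: "prog \<Rightarrow> nat \<Rightarrow> nat \<Rightarrow> baire \<Rightarrow> nat \<Rightarrow> nat" where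
  "forward e k j q s =
     (let i = if proposed (colouring_of q) (value_of e q) k j s < k then proposed (colouring_of q) (value_of e q) k j s else 0
      in if j \<le> k then answer (colouring_of q) (value_of e q) k j s i - 1 else i)"

lemma total_rec_forward: "total_rec (forward e k j)"
proof -
  have "total_rec (\<lambda>q s. forward e k j q s)"
    unfolding forward_def Let_def by (cases "j \<le> k") (simp_all, (intro rec_intros)+)
  then show ?thesis .
qed

definition first_answer :: "prog \<Rightarrow> nat \<Rightarrow> nat \<Rightarrow> baire \<Rightarrow> nat \<Rightarrow> nat" where
  "first_answer e k j q i = answer (colouring_of q) (value_of e q) k j
     (LEAST s. answer (colouring_of q) (value_of e q) k j s i \<noteq> 0) i - 1"

lemma eval_first_answer:
  "\<exists>g. \<forall>q i. (\<exists>s. answer (colouring_of q) (value_of e q) k j s i \<noteq> 0) \<longrightarrow> eval q g i (first_answer e k j q i)"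
proof -
  have "dec (\<lambda>q z. answer (colouring_of q) (value_of e q) k j (code_snd z) (code_fst z) \<noteq> 0)"
    by (intro rec_intros)
  from eval_search[of "\<lambda>q i s. answer (colouring_of q) (value_of e q) k j s i \<noteq> 0", OF this]
  obtain g where g: "\<And>q i. \<exists>s. answer (colouring_of q) (value_of e q) k j s i \<noteq> 0 \<Longrightarrow>
      eval q g i (LEAST s. answer (colouring_of q) (value_of e q) k j s i \<noteq> 0)" by blast
  have "total_rec (\<lambda>q z. answer (colouring_of q) (value_of e q) k j (code_snd z) (code_fst z) - 1)"
    by (intro rec_intros)
  then obtain g' where g': "\<And>q z. eval q g' z (answer (colouring_of q) (value_of e q) k j (code_snd z) (code_fst z) - 1)"
    unfolding total_rec_def by blast
  have id: "eval q (Join Left Right) n n" for q n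
    using eval_join[OF eval_code_fst[of q n] eval_code_snd[of q n]] by simp
  have "eval q (Comp g' (Join (Join Left Right) g)) i (first_answer e k j q i)"
    if ex: "\<exists>s. answer (colouring_of q) (value_of e q) k j s i \<noteq> 0" for q i
    using eval_comp[OF eval_join[OF id[of q i] g[OF ex]] g'] unfolding first_answer_def by simp
  then show ?thesis by blast
qed

lemma le_fin_RT1:
  fixes h :: "('x, nat) problem"
  assumes h: "is_problem h" "tgt h = fin_space j" and le: "h \<le>\<^sub>W TT1 k"
  shows "h \<le>\<^sub>W fin_RT1 j k"
proof -
  obtain H K where HK: "computable H" "computable K" and
    red: "\<And>G. realizes G (TT1 k) \<Longrightarrow>
      realizes (\<lambda>p. Option.bind (K p) (\<lambda>r. Option.bind (G r) (\<lambda>q. H (bpair p q)))) h"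
    using le unfolding weihrauch_le_def by blast
  obtain eH eK where eH: "\<And>p q n. H p = Some q \<Longrightarrow> eval p eH n (q n)"
    and eK: "\<And>p q n. K p = Some q \<Longrightarrow> eval p eK n (q n)"
    using HK unfolding computable_def by blast
  \<comment> \<open>\<open>K\<close> is known to be defined only on names of solvable instances;
    cutting domains down to these preserves computability.\<close>
  define dom where "dom p \<longleftrightarrow> (\<exists>x. src h p = Some x \<and> sol h x \<noteq> {})" for p
  define Q where "Q p = bpair p (the (K p))" for p
  have inst: "tree_answers (the (K p)) (value_of eH (Q p)) k j (sol h x) \<and> K p = Some (the (K p))"
    if "src h p = Some x" "sol h x \<noteq> {}" for p x
  proof -
    have "\<exists>r. K p = Some r \<and> tree_answers r (value_of eH (bpair p r)) k j (sol h x)"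
      by (rule reduction_instance[OF h _ _ that]) (erule eH, erule red)
    then show ?thesis by (auto simp: Q_def)
  qed
  have K_dom: "K p = Some (the (K p))" if "dom p" for p using that inst unfolding dom_def by blast
  define K' :: "baire \<rightharpoonup> baire" where "K' p = (if dom p then Some (forward eH k j (Q p)) else None)" for p
  \<comment> \<open>\<open>w 1\<close> is entry \<open>0\<close> of the name returned by the
    realizer, here a colour.\<close>
  define H' :: "baire \<rightharpoonup> baire" where "H' w = (if j \<le> k then Some (\<lambda>n. w (2 * n + 1)) else
      if dom (\<lambda>n. w (2 * n)) \<and> (\<exists>s. answer (colouring_of (Q (\<lambda>n. w (2 * n)))) (value_of eH (Q (\<lambda>n. w (2 * n)))) k j s (w 1) \<noteq> 0)
      then Some (\<lambda>_. first_answer eH k j (Q (\<lambda>n. w (2 * n))) (w 1)) else None)" for w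
  have "computable K'"
  proof -
    obtain g where g: "\<And>w p r n. (\<forall>n. eval w Query n (p n)) \<Longrightarrow> (\<forall>n. eval w eK n (r n)) \<Longrightarrow> eval w g n (bpair p r n)"
      using eval_bpair_ex[of Query eK] by blast
    obtain f where f: "\<And>q s. eval q f s (forward eH k j q s)"
      using total_rec_forward unfolding total_rec_def by blast
    show ?thesis
      unfolding computable_def
    proof (intro exI[of _ "subst g f"] allI impI)
      fix p q n assume "K' p = Some q"
      then have p: "dom p" "q = forward eH k j (Q p)" by (auto simp: K'_def split: if_splits)
      have "eval p g n (Q p n)" for n
        unfolding Q_def using eK[OF K_dom[OF p(1)]] by (intro g) (auto intro: eval_query)
      then show "eval p (subst g f) n (q n)" unfolding p(2) by (rule eval_subst[OF f])
    qed
  qed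
  moreover have "computable H'"
  proof (cases "j \<le> k")
    case True
    then have "H' = (\<lambda>w. Some (\<lambda>n. w (2 * n + 1)))" by (intro ext) (simp add: H'_def)
    then show ?thesis using computable_odd by simp
  next
    case False
    have "total_rec (\<lambda>w n. 2 * n)" "total_rec (\<lambda>w n. 1)" by (intro rec_intros)+
    from this[THEN total_rec_query] obtain ev one
      where ev: "\<And>w n. eval w ev n (w (2 * n))" and one: "\<And>w n. eval w one n (w 1)"
      unfolding total_rec_def by blast
    \<comment> \<open>The oracle of \<open>H'\<close> is a pair, so \<open>K\<close> is rerun on its
      even part to rebuild \<open>Q\<close>.\<close>
    obtain g where g: "\<And>w p r n. (\<forall>n. eval w ev n (p n)) \<Longrightarrow> (\<forall>n. eval w (subst ev eK) n (r n)) \<Longrightarrow> eval w g n (bpair p r n)"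
      using eval_bpair_ex[of ev "subst ev eK"] by blast
    obtain f where f: "\<And>q i. \<exists>s. answer (colouring_of q) (value_of eH q) k j s i \<noteq> 0 \<Longrightarrow> eval q f i (first_answer eH k j q i)"
      using eval_first_answer by blast
    show ?thesis
      unfolding computable_def
    proof (intro exI[of _ "Comp (subst g f) one"] allI impI)
      fix w u n assume "H' w = Some u"
      then have w: "dom (\<lambda>n. w (2 * n))"
        "\<exists>s. answer (colouring_of (Q (\<lambda>n. w (2 * n)))) (value_of eH (Q (\<lambda>n. w (2 * n)))) k j s (w 1) \<noteq> 0"
        "u n = first_answer eH k j (Q (\<lambda>n. w (2 * n))) (w 1)"
        using False by (auto simp: H'_def split: if_splits)
      have "eval w g n (Q (\<lambda>n. w (2 * n)) n)" for n
        unfolding Q_def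
      proof (rule g)
        show "\<forall>n. eval w ev n (w (2 * n))" using ev by blast
        show "\<forall>n. eval w (subst ev eK) n (the (K (\<lambda>n. w (2 * n))) n)"
          using eval_subst[OF eK[OF K_dom[OF w(1)]] ev] by blast
      qed
      then have "eval w (subst g f) (w 1) (u n)" unfolding w(3) by (rule eval_subst[OF f[OF w(2)]])
      then show "eval w (Comp (subst g f) one) n (u n)" using one by (blast intro: eval_comp)
    qed
  qed
  ultimately show ?thesis
  proof (intro weihrauch_leI)
    fix G p x assume G: "realizes G (fin_RT1 j k)" and p: "src h p = Some x" "sol h x \<noteq> {}"
    let ?r = "the (K p)" and ?V = "value_of eH (Q p)"
    interpret tree_answers ?r ?V k j "sol h x" using inst[OF p] by blast
    have Kp: "K' p = Some (forward eH k j (Q p))" using p by (auto simp: K'_def dom_def)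
    have col: "colouring_of (Q p) = ?r" by (simp add: Q_def)
    let ?d = "forward eH k j (Q p)"
    \<comment> \<open>Truncated subtraction turns a missing answer into \<open>0\<close>, which is a
      legal value because the instance has a solution below \<open>j\<close>.\<close>
    have j: "j > 0" using p(2) answers_less by fastforce
    have "?d s < min j k" for s
    proof -
      have "Ans s i < Suc j" for i by (simp add: digit_less)
      then have "Ans s i - 1 < j" for i using j by (metis Suc_diff_1 diff_Suc_1 less_Suc_eq less_imp_diff_less not_less_eq)
      then show ?thesis using k_pos by (auto simp: forward_def Let_def col intro: less_le_trans)
    qed
    then have src: "seq_colouring_space (min j k) ?d = Some ?d" and d: "\<forall>s. ?d s < min j k"
      by (auto simp: seq_colouring_space_def)
    \<comment> \<open>A realizer is bound only on solvable instances, so some value occurring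
      infinitely often has to be exhibited.\<close>
    have "finite (range ?d)" by (rule finite_subset[of _ "{..<min j k}"]) (use d in auto)
    then obtain s where "infinite {s' \<in> UNIV. ?d s' = ?d s}"
      using pigeonhole_infinite[of UNIV ?d] by auto
    then have "?d s \<in> sol (RT1 (min j k)) ?d"
      using d by (simp add: RT1_def vimage_def)
    then have sol: "sol (fin_RT1 j k) ?d \<noteq> {}" by auto
    obtain q y where q: "G ?d = Some q" "fin_space j q = Some y" "y < min j k" "infinite (?d -` {y})"
      by (rule realizesE[OF G _ sol]) (use src in \<open>auto simp: RT1_def\<close>)
    have y: "y = q 0" "y < j" using q(2) by (auto simp: fin_space_def split: if_splits)
    obtain s0 where s0: "\<And>s. s \<ge> s0 \<Longrightarrow> proposed ?r ?V k j s < k \<and> Ans s (proposed ?r ?V k j s) \<noteq> 0 \<and>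
        Ans s (proposed ?r ?V k j s) - 1 \<in> sol h x"
      using proposed_correct by blast
    obtain s where s: "s \<ge> s0" "?d s = y"
      using q(4) unfolding finite_nat_set_iff_bounded by (auto simp: not_less)
    have "\<exists>u. H' (bpair p q) = Some u \<and> fin_space j u = Some (u 0) \<and> u 0 \<in> sol h x"
    proof (cases "j \<le> k")
      case True
      then have "y = Ans s (proposed ?r ?V k j s) - 1" using s s0[OF s(1)] by (auto simp: forward_def col)
      then show ?thesis using True s0[OF s(1)] y by (auto simp: H'_def fin_space_def)
    next
      case False
      then have py: "y = proposed ?r ?V k j s" using s s0[OF s(1)] by (auto simp: forward_def col)
      then have sy: "Ans s y \<noteq> 0" "y < k" "Ans s y - 1 \<in> sol h x" using s0[OF s(1)] by auto
      \<comment> \<open>\<open>H'\<close> does not know \<open>s\<close>; it waits for the first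
        commitment for \<open>y\<close>, which persists to stage \<open>s\<close>.\<close>
      let ?l = "LEAST s. Ans s y \<noteq> 0"
      have "Ans ?l y \<noteq> 0" using LeastI[of "\<lambda>s. Ans s y \<noteq> 0", OF sy(1)] .
      moreover have "?l \<le> s" using Least_le[of "\<lambda>s. Ans s y \<noteq> 0", OF sy(1)] .
      ultimately have "Ans s y = Ans ?l y" using answer_persistent[OF sy(2)] by blast
      then have "first_answer eH k j (Q p) y \<in> sol h x" using sy(3) by (simp add: first_answer_def col)
      moreover have "H' (bpair p q) = Some (\<lambda>_. first_answer eH k j (Q p) y)"
        using False p sy(1) y(1) bpair_odd[of p q 0] by (auto simp: H'_def dom_def col)
      ultimately show ?thesis using answers_less by (auto simp: fin_space_def)
    qed
    then show "\<exists>r q u y. K' p = Some r \<and> G r = Some q \<and> H' (bpair p q) = Some u \<and> tgt h u = Some y \<and> y \<in> sol h x"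
      using Kp q(1) h(2) by auto
  qed
qed

theorem theorem27:
  fixes j k :: nat
  shows "\<exists>F :: (baire, nat) problem.
    is_finitary_part TYPE('x) j (TT1 k) F \<and> F \<equiv>\<^sub>W RT1 (min j k)"
  using is_problem_fin_RT1 fin_RT1_le_TT1 le_fin_RT1 fin_RT1_equiv
  unfolding is_finitary_part_def by (intro exI[of _ "fin_RT1 j k"]) auto

end
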